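(* Let $\mathcal C$ be a category of partitions, let $\mathcal P$ be a module of projective partitions over $\mathcal C$ and let $N$ be a positive integer. Put $H=\mathbb C^N$ and, for $p\in\mathcal P_n$, $\eta_p=T_p(e_1^{\otimes n})$; let $K_n^{\mathcal P}=\mathrm{span}\{\eta_p:p\in\mathcal P_n\}\subset H^{\otimes n}$ with the induced inner product, let $\iota_{k,l}:K_k^{\mathcal P}\otimes K_l^{\mathcal P}\to K_{k+l}^{\mathcal P}$ be given by $\eta_p\otimes\eta_q\mapsto\eta_{p\odot q}$, and for $r\in\mathcal C(k,l)$ let $$\varphi(r):K_k^{\mathcal P}\to K_l^{\mathcal P},\qquad\varphi(r)(\eta_p)=N^{\mathrm{rl}(r,p)}\eta_{rpr^*}.$$ Then $T_r\mapsto\varphi(r)$ extends to well-defined linear maps $\varphi:\mathrm{Mor}_{\mathbb G_N(\mathcal C)}(k,l)\to B(K_k^{\mathcal P},K_l^{\mathcal P})$ for all $k,l$, and the system $((K_n^{\mathcal P})_n,\varphi,\iota)$ satisfies: $K_0^{\mathcal P}=\mathbb C$; (F1) $\varphi(\mathrm{id})=\mathrm{id}$, $\varphi(T^* )=\varphi(T)^*$ and $\varphi(TS)=\varphi(T)\varphi(S)$ for composable intertwiners; (F2) the $\iota_{k,l}$ are isometric, $\iota_{k+l,m}(\iota_{k,l}\otimes\mathrm{id})=\iota_{k,l+m}(\mathrm{id}\otimes\iota_{l,m})=:\iota_{k,l,m}$, and $\varphi(T\otimes S)\iota_{k,l}=\iota_{k',l'}(\varphi(T)\otimes\varphi(S))$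 for $T\in\mathrm{Mor}(k,k')$, $S\in\mathrm{Mor}(l,l')$; (F3) $P_{k+l,m}P_{k,l+m}\le P_{k,l,m}$, where these are the range projections of $\iota_{k+l,m},\iota_{k,l+m},\iota_{k,l,m}$.
   Context: Partitions. $P(k,l)$ is the set of set partitions of $k$ upper points and $l$ lower points. For $p\in P(k,l)$, $q\in P(m,n)$, $p\odot q\in P(k+m,l+n)$ is horizontal concatenation. For $p\in P(k,l)$, $q\in P(l,m)$, $qp\in P(k,m)$ is vertical concatenation ($p$ on top, its lower points glued to the upper points of $q$), where components made only of middle points ("loops") are removed; their number is $\mathrm{rl}(q,p)$. $p^*\in P(l,k)$ is the reflection across a horizontal axis. A category of partitions $\mathcal C$ is a family $\mathcal C(k,l)\subset P(k,l)$ stable under these operations and containing the identity $|\in P(1,1)$ and the pair partition $\sqcap\in P(0,2)$. For $p\in P(k,l)$, $T_p:(\mathbb C^N)^{\otimes k}\to(\mathbb C^N)^{\otimes l}$ is $T_p(e_{i_1}\otimes\cdots\otimes e_{i_k})=\sum_{j_1,\dots,j_l=1}^N\delta_p(\mathbf i,\mathbf j)e_{j_1}\otimes\cdots\otimes e_{j_l}$, where $\delta_p(\mathbf i,\mathbf j)=1$ if indices in the same block are equal and $0$ otherwise. The easy quantum group $\mathbb G_N(\mathcal C)$ is the compact quantum group with self-conjugate fundamental unitary representation $u$ on $\mathbb C^N$ such that $\mathrm{Mor}(k,l):=\mathrm{Mor}_{\mathbb G_N(\mathcal C)}(u^{\boxtimes k},u^{\boxtimes l})=\mathrm{span}\{T_p:p\in\mathcal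 C(k,l)\}$ for all $k,l$. A partition $p\in P(k,k)$ is projective if $pp=p=p^*$. $D_m\in P(0,2m)$ is the pair partition with blocks $\{i,2m-i+1\}$, and for $p\in P(m,m)$, $\overline p=(D_m^*\odot|^{\odot m})(|^{\odot m}\odot p\odot|^{\odot m})(|^{\odot m}\odot D_m)$ ($p$ rotated upside-down). A module of projective partitions over $\mathcal C$ is a non-empty set $\mathcal P$ of projective partitions (not necessarily in $\mathcal C$) such that, with $\mathcal P_k=\mathcal P\cap P(k,k)$: (1) $\mathcal P_k\odot\mathcal P_l\subset\mathcal P_{k+l}$; (2) $rpr^*\in\mathcal P_l$ for $r\in\mathcal C(k,l)$, $p\in\mathcal P_k$; (3) $\overline p\in\mathcal P_k$ for $p\in\mathcal P_k$. *)

theory Defs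
  imports
    "HOL-Analysis.Analysis"
    "HOL-Library.Function_Algebras"
    "HOL-Library.Disjoint_Sets"
    "HOL-Algebra.Module"
begin

section \<open>Partitions\<close>

text \<open>The upper points of an element of \<open>P(k,l)\<close> are \<open>Inl 0, \<dots>, Inl (k-1)\<close>, the lower points are
  \<open>Inr 0, \<dots>, Inr (l-1)\<close>; a partition is its set of blocks.\<close>

type_synonym part = "(nat + nat) set set"

definition parts :: "nat \<Rightarrow> nat \<Rightarrow> part set" where
  "parts k l = {p. partition_on (Inl ` {..<k} \<union> Inr ` {..<l}) p}"

definition id_part :: "nat \<Rightarrow> part" where
  "id_part n = {{Inl i, Inr i} | i. i < n}"

definition pair_part :: part where
  "pair_part = {{Inr 0, Inr 1}}"

text \<open>Horizontal concatenation of \<open>p \<in> P(k,l)\<close> (left) and \<open>q\<close> (right).\<close>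

definition hcat :: "nat \<Rightarrow> nat \<Rightarrow> part \<Rightarrow> part \<Rightarrow> part" where
  "hcat k l p q = p \<union> (`) (map_sum (\<lambda>i. k + i) (\<lambda>j. l + j)) ` q"

text \<open>For the vertical concatenation \<open>qp\<close> the points live on three rows: upper points \<open>Inl i\<close>,
  middle points \<open>Inr (Inl j)\<close> and lower points \<open>Inr (Inr m)\<close>. The connected components are the
  classes of the transitive closure of ``lying in a common block of \<open>p\<close> or of \<open>q\<close>''.\<close>

definition components :: "'a set set \<Rightarrow> 'a set set" where
  "components S = \<Union>S // ({(x, y). \<exists>B\<in>S. x \<in> B \<and> y \<in> B}\<^sup>+)"

definition glued_components :: "part \<Rightarrow> part \<Rightarrow> (nat + nat + nat) set set" where
  "glued_components q p = components ((`) (map_sum id Inl) ` p \<union> (`) Inr ` q)"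

definition vcat :: "part \<Rightarrow> part \<Rightarrow> part" where
  "vcat q p = {map_sum id Inr -` c | c. c \<in> glued_components q p} - {{}}"

definition rl :: "part \<Rightarrow> part \<Rightarrow> nat" where
  "rl q p = card {c \<in> glued_components q p. c \<subseteq> range (Inr \<circ> Inl)}"

definition pstar :: "part \<Rightarrow> part" where
  "pstar p = (`) (case_sum Inr Inl) ` p"

definition category_of_partitions :: "(nat \<Rightarrow> nat \<Rightarrow> part set) \<Rightarrow> bool" where
  "category_of_partitions C \<longleftrightarrow>
     (\<forall>k l. C k l \<subseteq> parts k l) \<and>
     (\<forall>k l m n. \<forall>p\<in>C k l. \<forall>q\<in>C m n. hcat k l p q \<in> C (k + m) (l + n)) \<and>
     (\<forall>k l m. \<forall>p\<in>C k l. \<forall>q\<in>C l m. vcat q p \<in> C k m) \<and>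
     (\<forall>k l. \<forall>p\<in>C k l. pstar p \<in> C l k) \<and>
     id_part 1 \<in> C 1 1 \<and> pair_part \<in> C 0 2"

definition projective_partition :: "nat \<Rightarrow> part \<Rightarrow> bool" where
  "projective_partition k p \<longleftrightarrow> p \<in> parts k k \<and> vcat p p = p \<and> pstar p = p"

text \<open>The nested pair partition \<open>D\<^sub>m\<close>; as points are numbered from 0, \<open>i\<close> is paired with
  \<open>2m - 1 - i\<close>.\<close>

definition nested_pairs :: "nat \<Rightarrow> part" where
  "nested_pairs m = {{Inr i, Inr (2 * m - 1 - i)} | i. i < m}"

definition pbar :: "nat \<Rightarrow> part \<Rightarrow> part" where
  "pbar m p =
     vcat (hcat (2 * m) 0 (pstar (nested_pairs m)) (id_part m))
       (vcat (hcat (m + m) (m + m) (hcat m m (id_part m) p) (id_part m))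
             (hcat m m (id_part m) (nested_pairs m)))"

definition module_of_projective_partitions :: "(nat \<Rightarrow> nat \<Rightarrow> part set) \<Rightarrow> part set \<Rightarrow> bool" where
  "module_of_projective_partitions C P \<longleftrightarrow>
     P \<noteq> {} \<and> (\<forall>p\<in>P. \<exists>k. projective_partition k p) \<and>
     (\<forall>k l. \<forall>p\<in>P \<inter> parts k k. \<forall>q\<in>P \<inter> parts l l. hcat k k p q \<in> P \<inter> parts (k + l) (k + l)) \<and>
     (\<forall>k l. \<forall>r\<in>C k l. \<forall>p\<in>P \<inter> parts k k. vcat (vcat r p) (pstar r) \<in> P \<inter> parts l l) \<and>
     (\<forall>k. \<forall>p\<in>P \<inter> parts k k. pbar k p \<in> P \<inter> parts k k)"


section \<open>Vectors and operators\<close>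

text \<open>The space \<open>(\<complex>\<^sup>N)\<^sup>\<otimes>\<^sup>n\<close> consists of the functions supported on the multi-indices of length \<open>n\<close>
  with entries in \<open>{1..N}\<close>; an operator is its matrix, indexed by pairs (row, column).
  The tensor product of two spaces of functions lives on the pairs of indices, so that
  \<open>(\<complex>\<^sup>N)\<^sup>\<otimes>\<^sup>k \<otimes> (\<complex>\<^sup>N)\<^sup>\<otimes>\<^sup>l\<close> and \<open>(\<complex>\<^sup>N)\<^sup>\<otimes>\<^sup>k\<^sup>+\<^sup>l\<close> are kept apart. All vectors considered have finite support.\<close>

type_synonym 'i cvec = "'i \<Rightarrow> complex"
type_synonym mind = "nat list"
type_synonym op = "(mind \<times> mind) cvec"

definition idx :: "nat \<Rightarrow> nat \<Rightarrow> mind set" where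
  "idx N n = {is. length is = n \<and> set is \<subseteq> {1..N}}"

definition cscale :: "complex \<Rightarrow> 'i cvec \<Rightarrow> 'i cvec" where
  "cscale c x = (\<lambda>i. c * x i)"

global_interpretation cvec: vector_space "cscale :: complex \<Rightarrow> 'i cvec \<Rightarrow> 'i cvec"
  defines cspan = cvec.span
  by unfold_locales (auto simp: cscale_def algebra_simps)

definition cinner :: "'i cvec \<Rightarrow> 'i cvec \<Rightarrow> complex" where
  "cinner x y = (\<Sum>i | x i \<noteq> 0. x i * cnj (y i))"

definition linear_map_on :: "'i cvec set \<Rightarrow> 'j cvec set \<Rightarrow> ('i cvec \<Rightarrow> 'j cvec) \<Rightarrow> bool" where
  "linear_map_on V W f \<longleftrightarrow> f ` V \<subseteq> W \<and>
     (\<forall>x\<in>V. \<forall>y\<in>V. f (x + y) = f x + f y) \<and> (\<forall>c. \<forall>x\<in>V. f (cscale c x) = cscale c (f x))"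

definition isometric_on :: "'i cvec set \<Rightarrow> ('i cvec \<Rightarrow> 'j cvec) \<Rightarrow> bool" where
  "isometric_on V f \<longleftrightarrow> (\<forall>x\<in>V. \<forall>y\<in>V. cinner (f x) (f y) = cinner x y)"

definition adjoint_on :: "'i cvec set \<Rightarrow> 'j cvec set \<Rightarrow> ('i cvec \<Rightarrow> 'j cvec) \<Rightarrow> ('j cvec \<Rightarrow> 'i cvec) \<Rightarrow> bool" where
  "adjoint_on V W f g \<longleftrightarrow> (\<forall>x\<in>V. \<forall>y\<in>W. cinner (f x) y = cinner x (g y))"

definition tensor_vec :: "'i cvec \<Rightarrow> 'j cvec \<Rightarrow> ('i \<times> 'j) cvec" where
  "tensor_vec x y = (\<lambda>(i, j). x i * y j)"

definition tensor_space :: "'i cvec set \<Rightarrow> 'j cvec set \<Rightarrow> ('i \<times> 'j) cvec set" where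
  "tensor_space V W = cspan {tensor_vec x y | x y. x \<in> V \<and> y \<in> W}"

text \<open>\<open>f \<otimes> g\<close> for linear maps \<open>f\<close> on \<open>V\<close> and \<open>g\<close> on \<open>W\<close>: for \<open>t \<in> V \<otimes> W\<close> every slice
  \<open>\<lambda>i. t (i, j)\<close> lies in \<open>V\<close>, and applying first \<open>f\<close> and then \<open>g\<close> slicewise gives the unique linear
  map with \<open>x \<otimes> y \<mapsto> f x \<otimes> g y\<close> on \<open>V \<otimes> W\<close>.\<close>

definition tensor_map ::
  "('i cvec \<Rightarrow> 'i2 cvec) \<Rightarrow> ('j cvec \<Rightarrow> 'j2 cvec) \<Rightarrow> ('i \<times> 'j) cvec \<Rightarrow> ('i2 \<times> 'j2) cvec" where
  "tensor_map f g t = (\<lambda>(i', j'). g (\<lambda>j. f (\<lambda>i. t (i, j)) i') j')"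

definition tensor_assoc :: "(('i \<times> 'j) \<times> 'k) cvec \<Rightarrow> ('i \<times> ('j \<times> 'k)) cvec" where
  "tensor_assoc t = (\<lambda>(i, (j, k)). t ((i, j), k))"

definition orth_proj :: "'i cvec set \<Rightarrow> 'i cvec \<Rightarrow> 'i cvec" where
  "orth_proj V x = (THE y. y \<in> V \<and> (\<forall>z\<in>V. cinner (x - y) z = 0))"

text \<open>The order of operators on a Hilbert space \<open>V\<close>: \<open>B - A\<close> is positive.\<close>

definition op_le_on :: "'i cvec set \<Rightarrow> ('i cvec \<Rightarrow> 'i cvec) \<Rightarrow> ('i cvec \<Rightarrow> 'i cvec) \<Rightarrow> bool" where
  "op_le_on V A B \<longleftrightarrow> (\<forall>x\<in>V. cinner (B x - A x) x \<in> \<real> \<and> 0 \<le> Re (cinner (B x - A x) x))"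

definition mat_id :: "nat \<Rightarrow> nat \<Rightarrow> op" where
  "mat_id N k = (\<lambda>(j, i). if i \<in> idx N k \<and> j = i then 1 else 0)"

text \<open>\<open>T S\<close> for \<open>S : (\<complex>\<^sup>N)\<^sup>\<otimes>\<^sup>k \<rightarrow> (\<complex>\<^sup>N)\<^sup>\<otimes>\<^sup>l\<close> and \<open>T : (\<complex>\<^sup>N)\<^sup>\<otimes>\<^sup>l \<rightarrow> (\<complex>\<^sup>N)\<^sup>\<otimes>\<^sup>m\<close>.\<close>

definition mat_mult :: "nat \<Rightarrow> nat \<Rightarrow> op \<Rightarrow> op \<Rightarrow> op" where
  "mat_mult N l T S = (\<lambda>(m, i). \<Sum>j\<in>idx N l. T (m, j) * S (j, i))"

definition mat_adj :: "op \<Rightarrow> op" where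
  "mat_adj T = (\<lambda>(i, j). cnj (T (j, i)))"

text \<open>\<open>T \<otimes> S\<close> for \<open>T : (\<complex>\<^sup>N)\<^sup>\<otimes>\<^sup>k \<rightarrow> (\<complex>\<^sup>N)\<^sup>\<otimes>\<^sup>k\<^sup>'\<close> and arbitrary \<open>S\<close>, under
  \<open>(\<complex>\<^sup>N)\<^sup>\<otimes>\<^sup>m \<otimes> (\<complex>\<^sup>N)\<^sup>\<otimes>\<^sup>n = (\<complex>\<^sup>N)\<^sup>\<otimes>\<^sup>m\<^sup>+\<^sup>n\<close>.\<close>

definition mat_tensor :: "nat \<Rightarrow> nat \<Rightarrow> op \<Rightarrow> op \<Rightarrow> op" where
  "mat_tensor k k' T S = (\<lambda>(j, i). T (take k' j, take k i) * S (drop k' j, drop k i))"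

definition mat_apply :: "nat \<Rightarrow> nat \<Rightarrow> op \<Rightarrow> mind cvec \<Rightarrow> mind cvec" where
  "mat_apply N k T x = (\<lambda>j. \<Sum>i\<in>idx N k. T (j, i) * x i)"


section \<open>Operators of partitions, the spaces of the module\<close>

definition delta :: "part \<Rightarrow> mind \<Rightarrow> mind \<Rightarrow> bool" where
  "delta p i j \<longleftrightarrow>
     (\<forall>B\<in>p. \<forall>x\<in>B. \<forall>y\<in>B. case_sum (nth i) (nth j) x = case_sum (nth i) (nth j) y)"

definition T_part :: "nat \<Rightarrow> nat \<Rightarrow> nat \<Rightarrow> part \<Rightarrow> op" where
  "T_part N k l p = (\<lambda>(j, i). if i \<in> idx N k \<and> j \<in> idx N l \<and> delta p i j then 1 else 0)"

definition e1_pow :: "nat \<Rightarrow> mind cvec" where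
  "e1_pow n = (\<lambda>i. if i = replicate n 1 then 1 else 0)"

definition eta :: "nat \<Rightarrow> nat \<Rightarrow> part \<Rightarrow> mind cvec" where
  "eta N n p = mat_apply N n (T_part N n n p) (e1_pow n)"

definition K_space :: "nat \<Rightarrow> part set \<Rightarrow> nat \<Rightarrow> mind cvec set" where
  "K_space N P n = cspan (eta N n ` (P \<inter> parts n n))"


section \<open>Compact quantum groups with a fundamental representation\<close>

text \<open>A compact quantum group with a fundamental representation \<open>u\<close> is given by its Hopf
  *-algebra of matrix coefficients: a Hopf *-algebra generated by the entries of a unitary
  corepresentation matrix \<open>u = (u\<^sub>i\<^sub>j)\<close>. The complex algebra is a \<^term>\<open>ring\<close> and \<^term>\<open>module\<close> in
  the sense of HOL-Algebra; it need not be commutative.\<close>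

definition complex_ring :: "complex ring" where
  "complex_ring = \<lparr>carrier = UNIV, monoid.mult = (*), one = 1, ring.zero = 0, add = (+)\<rparr>"

record 'a qgroup = "(complex, 'a) module" +
  invol :: "'a \<Rightarrow> 'a"
  comult :: "'a \<Rightarrow> ('a \<times> 'a) list"
  counit :: "'a \<Rightarrow> complex"
  antipode :: "'a \<Rightarrow> 'a"
  fund :: "nat \<Rightarrow> nat \<Rightarrow> 'a"

definition functionals :: "(complex, 'a, 'm) module_scheme \<Rightarrow> ('a \<Rightarrow> complex) set" where
  "functionals A = {f. (\<forall>x\<in>carrier A. \<forall>y\<in>carrier A. f (x \<oplus>\<^bsub>A\<^esub> y) = f x + f y) \<and>
                       (\<forall>c. \<forall>x\<in>carrier A. f (c \<odot>\<^bsub>A\<^esub> x) = c * f x)}"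

text \<open>An element \<open>\<Sum> a\<^sub>i \<otimes> b\<^sub>i\<close> of the algebraic tensor product \<open>A \<otimes> A\<close> is represented by the list of
  the pairs \<open>(a\<^sub>i, b\<^sub>i)\<close>. Two lists represent the same element iff they agree under \<open>f \<otimes> g\<close> for
  all linear functionals \<open>f\<close>, \<open>g\<close>, since these separate the points of \<open>A \<otimes> A\<close>; likewise for
  \<open>A \<otimes> A \<otimes> A\<close>.\<close>

definition tensor2_eq ::
  "(complex, 'a, 'm) module_scheme \<Rightarrow> ('a \<times> 'a) list \<Rightarrow> ('a \<times> 'a) list \<Rightarrow> bool" where
  "tensor2_eq A s t \<longleftrightarrow> (\<forall>f\<in>functionals A. \<forall>g\<in>functionals A.
     (\<Sum>(a, b)\<leftarrow>s. f a * g b) = (\<Sum>(a, b)\<leftarrow>t. f a * g b))"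

definition tensor3_eq ::
  "(complex, 'a, 'm) module_scheme \<Rightarrow> ('a \<times> 'a \<times> 'a) list \<Rightarrow> ('a \<times> 'a \<times> 'a) list \<Rightarrow> bool" where
  "tensor3_eq A s t \<longleftrightarrow>
     (\<forall>f\<in>functionals A. \<forall>g\<in>functionals A. \<forall>h\<in>functionals A.
       (\<Sum>(a, b, c)\<leftarrow>s. f a * g b * h c) = (\<Sum>(a, b, c)\<leftarrow>t. f a * g b * h c))"

definition lsum :: "('a, 'm) ring_scheme \<Rightarrow> 'a list \<Rightarrow> 'a" where
  "lsum A xs = foldr (add A) xs \<zero>\<^bsub>A\<^esub>"

definition lprod :: "('a, 'm) monoid_scheme \<Rightarrow> 'a list \<Rightarrow> 'a" where
  "lprod A xs = foldr (mult A) xs \<one>\<^bsub>A\<^esub>"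

locale complex_star_algebra = ring A + module complex_ring A for A :: "('a, 'm) qgroup_scheme" (structure) +
  assumes smult_mult_left:
      "x \<in> carrier A \<Longrightarrow> y \<in> carrier A \<Longrightarrow> (c \<odot> x) \<otimes> y = c \<odot> (x \<otimes> y)"
    and smult_mult_right:
      "x \<in> carrier A \<Longrightarrow> y \<in> carrier A \<Longrightarrow> x \<otimes> (c \<odot> y) = c \<odot> (x \<otimes> y)"
    and invol_closed: "x \<in> carrier A \<Longrightarrow> invol A x \<in> carrier A"
    and invol_invol: "x \<in> carrier A \<Longrightarrow> invol A (invol A x) = x"
    and invol_add:
      "x \<in> carrier A \<Longrightarrow> y \<in> carrier A \<Longrightarrow> invol A (x \<oplus> y) = invol A x \<oplus> invol A y"
    and invol_smult: "x \<in> carrier A \<Longrightarrow> invol A (c \<odot> x) = cnj c \<odot> invol A x"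
    and invol_mult:
      "x \<in> carrier A \<Longrightarrow> y \<in> carrier A \<Longrightarrow> invol A (x \<otimes> y) = invol A y \<otimes> invol A x"

locale hopf_star_algebra = complex_star_algebra A for A :: "('a, 'm) qgroup_scheme" (structure) +
  assumes comult_closed: "x \<in> carrier A \<Longrightarrow> set (comult A x) \<subseteq> carrier A \<times> carrier A"
    and comult_add: "x \<in> carrier A \<Longrightarrow> y \<in> carrier A \<Longrightarrow>
      tensor2_eq A (comult A (x \<oplus> y)) (comult A x @ comult A y)"
    and comult_smult: "x \<in> carrier A \<Longrightarrow>
      tensor2_eq A (comult A (c \<odot> x)) [(c \<odot> a, b). (a, b) \<leftarrow> comult A x]"
    and comult_one: "tensor2_eq A (comult A \<one>) [(\<one>, \<one>)]"
    and comult_mult: "x \<in> carrier A \<Longrightarrow> y \<in> carrier A \<Longrightarrow>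
      tensor2_eq A (comult A (x \<otimes> y)) [(a \<otimes> c, b \<otimes> d). (a, b) \<leftarrow> comult A x, (c, d) \<leftarrow> comult A y]"
    and comult_invol: "x \<in> carrier A \<Longrightarrow>
      tensor2_eq A (comult A (invol A x)) [(invol A a, invol A b). (a, b) \<leftarrow> comult A x]"
    and coassoc: "x \<in> carrier A \<Longrightarrow>
      tensor3_eq A [(a, a', b). (c, b) \<leftarrow> comult A x, (a, a') \<leftarrow> comult A c]
                   [(a, b, b'). (a, c) \<leftarrow> comult A x, (b, b') \<leftarrow> comult A c]"
    and counit_linear: "counit A \<in> functionals A"
    and counit_one: "counit A \<one> = 1"
    and counit_mult: "x \<in> carrier A \<Longrightarrow> y \<in> carrier A \<Longrightarrow>
      counit A (x \<otimes> y) = counit A x * counit A y"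
    and counit_left: "x \<in> carrier A \<Longrightarrow> lsum A [counit A a \<odot> b. (a, b) \<leftarrow> comult A x] = x"
    and counit_right: "x \<in> carrier A \<Longrightarrow> lsum A [counit A b \<odot> a. (a, b) \<leftarrow> comult A x] = x"
    and antipode_closed: "x \<in> carrier A \<Longrightarrow> antipode A x \<in> carrier A"
    and antipode_add: "x \<in> carrier A \<Longrightarrow> y \<in> carrier A \<Longrightarrow>
      antipode A (x \<oplus> y) = antipode A x \<oplus> antipode A y"
    and antipode_smult: "x \<in> carrier A \<Longrightarrow> antipode A (c \<odot> x) = c \<odot> antipode A x"
    and antipode_left: "x \<in> carrier A \<Longrightarrow>
      lsum A [antipode A a \<otimes> b. (a, b) \<leftarrow> comult A x] = counit A x \<odot> \<one>"
    and antipode_right: "x \<in> carrier A \<Longrightarrow>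
      lsum A [a \<otimes> antipode A b. (a, b) \<leftarrow> comult A x] = counit A x \<odot> \<one>"

locale compact_matrix_quantum_group = hopf_star_algebra G
  for N :: nat and G :: "('a, 'm) qgroup_scheme" (structure) +
  assumes fund_closed: "i \<in> {1..N} \<Longrightarrow> j \<in> {1..N} \<Longrightarrow> fund G i j \<in> carrier G"
    and fund_comult: "i \<in> {1..N} \<Longrightarrow> j \<in> {1..N} \<Longrightarrow>
      tensor2_eq G (comult G (fund G i j)) [(fund G i k, fund G k j). k \<leftarrow> [1..<Suc N]]"
    and fund_unitary_left: "i \<in> {1..N} \<Longrightarrow> j \<in> {1..N} \<Longrightarrow>
      (\<Oplus>k\<in>{1..N}. fund G i k \<otimes> invol G (fund G j k)) = (if i = j then \<one> else \<zero>)"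
    and fund_unitary_right: "i \<in> {1..N} \<Longrightarrow> j \<in> {1..N} \<Longrightarrow>
      (\<Oplus>k\<in>{1..N}. invol G (fund G k i) \<otimes> fund G k j) = (if i = j then \<one> else \<zero>)"
    and fund_generates: "\<And>S. S \<subseteq> carrier G \<Longrightarrow> \<one> \<in> S \<Longrightarrow>
      (\<And>i j. i \<in> {1..N} \<Longrightarrow> j \<in> {1..N} \<Longrightarrow> fund G i j \<in> S) \<Longrightarrow>
      (\<And>x y. x \<in> S \<Longrightarrow> y \<in> S \<Longrightarrow> x \<oplus> y \<in> S) \<Longrightarrow>
      (\<And>x y. x \<in> S \<Longrightarrow> y \<in> S \<Longrightarrow> x \<otimes> y \<in> S) \<Longrightarrow>
      (\<And>c x. x \<in> S \<Longrightarrow> c \<odot> x \<in> S) \<Longrightarrow>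
      (\<And>x. x \<in> S \<Longrightarrow> invol G x \<in> S) \<Longrightarrow> S = carrier G"

text \<open>\<open>u\<close> is equivalent to its conjugate \<open>(u\<^sub>i\<^sub>j\<^sup>*)\<close>, through an invertible matrix \<open>F\<close>. For easy quantum
  groups this forces \<open>u\<^sub>i\<^sub>j = u\<^sub>i\<^sub>j\<^sup>*\<close>, because the pair partition is in the category.\<close>

definition self_conjugate :: "nat \<Rightarrow> ('a, 'm) qgroup_scheme \<Rightarrow> bool" where
  "self_conjugate N G \<longleftrightarrow> (\<exists>F F' :: nat \<Rightarrow> nat \<Rightarrow> complex.
     (\<forall>a\<in>{1..N}. \<forall>b\<in>{1..N}.
        (\<Sum>c\<in>{1..N}. F a c * F' c b) = (if a = b then 1 else 0) \<and>
        (\<Sum>c\<in>{1..N}. F' a c * F c b) = (if a = b then 1 else 0) \<and>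
        (\<Oplus>\<^bsub>G\<^esub>c\<in>{1..N}. F a c \<odot>\<^bsub>G\<^esub> fund G c b) =
        (\<Oplus>\<^bsub>G\<^esub>c\<in>{1..N}. F c b \<odot>\<^bsub>G\<^esub> invol G (fund G a c))))"

text \<open>The coefficient \<open>(i, j)\<close> of \<open>u\<^bsup>\<boxtimes>k\<^esup>\<close> is \<open>u\<^bsub>i\<^sub>1 j\<^sub>1\<^esub> \<cdots> u\<^bsub>i\<^sub>k j\<^sub>k\<^esub>\<close>.\<close>

definition fund_pow :: "('a, 'm) qgroup_scheme \<Rightarrow> mind \<Rightarrow> mind \<Rightarrow> 'a" where
  "fund_pow G i j = lprod G (map2 (fund G) i j)"

text \<open>The space of intertwiners from \<open>u\<^bsup>\<boxtimes>k\<^esup>\<close> to \<open>u\<^bsup>\<boxtimes>l\<^esup>\<close>: the \<open>T\<close> with \<open>T u\<^bsup>\<boxtimes>k\<^esup> = u\<^bsup>\<boxtimes>l\<^esup> T\<close>.\<close>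

definition Mor :: "nat \<Rightarrow> ('a, 'm) qgroup_scheme \<Rightarrow> nat \<Rightarrow> nat \<Rightarrow> op set" where
  "Mor N G k l = {T. (\<forall>j i. T (j, i) \<noteq> 0 \<longrightarrow> j \<in> idx N l \<and> i \<in> idx N k) \<and>
     (\<forall>j\<in>idx N l. \<forall>i\<in>idx N k.
        (\<Oplus>\<^bsub>G\<^esub>i'\<in>idx N k. T (j, i') \<odot>\<^bsub>G\<^esub> fund_pow G i' i) =
        (\<Oplus>\<^bsub>G\<^esub>j'\<in>idx N l. T (j', i) \<odot>\<^bsub>G\<^esub> fund_pow G j j'))}"

definition easy_quantum_group ::
  "nat \<Rightarrow> (nat \<Rightarrow> nat \<Rightarrow> part set) \<Rightarrow> ('a, 'm) qgroup_scheme \<Rightarrow> bool" where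
  "easy_quantum_group N C G \<longleftrightarrow>
     compact_matrix_quantum_group N G \<and> self_conjugate N G \<and>
     (\<forall>k l. Mor N G k l = cspan (T_part N k l ` C k l))"

end

theory Submission
  imports Defs
begin

text \<open>
  The representation \<open>\<phi>\<close> is the defining one, restricted: an intertwiner \<open>T\<close> acts on \<open>K\<^sub>k\<close> as the
  operator \<open>T\<close> itself, and \<open>\<iota>\<close> is the identification \<open>H\<^sup>\<otimes>\<^sup>k \<otimes> H\<^sup>\<otimes>\<^sup>l = H\<^sup>\<otimes>\<^sup>k\<^sup>+\<^sup>l\<close>, restricted to
  \<open>K\<^sub>k \<otimes> K\<^sub>l\<close>. Well-definedness, (F1) and (F2) then come from the operators on the whole tensor
  powers, once the spaces are known to be respected. This is the formula
  \<open>T\<^sub>r \<eta>\<^sub>p = N\<^bsup>rl(r,p)\<^esup> \<eta>\<^bsub>rpr*\<^esub>\<close> (lemma \<open>T_part_eta\<close>) together with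
  \<open>\<eta>\<^sub>p \<otimes> \<eta>\<^sub>q = \<eta>\<^bsub>p\<odot>q\<^esub>\<close> (lemma \<open>eta_hcat\<close>).

  The formula for \<open>T\<^sub>r \<eta>\<^sub>p\<close> has two ingredients. Summing over the middle row of a composition counts
  the labellings of the middle points that are constant on the glued components; the components
  that meet an outer row leave no choice and each loop leaves \<open>N\<close> choices
  (lemma \<open>card_middle_labellings\<close>). Hence \<open>T\<^sub>r \<eta>\<^sub>p = N\<^bsup>rl(r,p)\<^esup> T\<^bsub>rp\<^esub> e\<^sub>1\<^sup>\<otimes>\<^sup>k\<close>, and it remains to see that
  \<open>T\<^bsub>rp\<^esub> e\<^sub>1\<^sup>\<otimes>\<^sup>k = T\<^bsub>rpr*\<^esub> e\<^sub>1\<^sup>\<otimes>\<^sup>l\<close>. Instead of following paths through the diagram of \<open>rpr*\<close>, the proof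
  combines the labels of the two middle rows of \<open>rpr*\<close> by a function of two labels; projectivity of \<open>p\<close>
  makes the two rows agree on through-blocks, so that the combined row is admissible for \<open>rp\<close> with
  all upper labels equal to 1 (lemma \<open>delta_conjugate\<close>).

  For (F3), write an element of the range of \<open>\<iota>\<^bsub>k,l+m\<^esub>\<close> as a combination of vectors \<open>x \<otimes> z\<close> with
  \<open>x \<in> K\<^sub>k\<close> and \<open>z \<in> K\<^bsub>l+m\<^esub>\<close>, and let \<open>y\<close> be the orthogonal projection of \<open>z\<close> onto \<open>K\<^sub>l \<otimes> K\<^sub>m\<close>. The key is
  that slicing preserves the spaces: \<open>(id \<otimes> \<eta>\<^sub>s\<^sup>*) z \<in> K\<^sub>l\<close> for \<open>s \<in> P\<^sub>m\<close> (lemma \<open>slice_mem\<close>), because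
  \<open>\<eta>\<^sub>s\<^sup>*\<close> is obtained by tensoring with \<open>\<eta>\<close> of the rotated partition and contracting nested pairs, which
  is an operator of the category. So the slice of \<open>z - y\<close> lies in \<open>K\<^sub>l\<close>, and it is orthogonal to \<open>K\<^sub>l\<close>
  since \<open>z - y\<close> is orthogonal to \<open>K\<^sub>l \<otimes> K\<^sub>m\<close>; it vanishes. Therefore \<open>x \<otimes> (z - y)\<close> is orthogonal to
  \<open>a \<otimes> \<eta>\<^sub>s\<close> for every vector \<open>a\<close>, the projection of \<open>x \<otimes> z\<close> onto \<open>K\<^bsub>k+l\<^esub> \<otimes> K\<^sub>m\<close> is
  \<open>x \<otimes> y \<in> K\<^sub>k \<otimes> K\<^sub>l \<otimes> K\<^sub>m\<close>, and the inequality in (F3) is even an equality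
  (lemma \<open>projections_compose\<close>).
\<close>

section \<open>Labellings of glued partitions\<close>

lemma partition_on_components: "partition_on (\<Union>S) (components S)"
proof -
  let ?R = "{(x, y). \<exists>B\<in>S. x \<in> B \<and> y \<in> B}"
  have "?R\<^sup>+ \<subseteq> \<Union>S \<times> \<Union>S"
    by (rule trancl_subset_Sigma) auto
  moreover have "sym (?R\<^sup>+)"
    by (rule sym_trancl) (auto simp: sym_def)
  ultimately have "equiv (\<Union>S) (?R\<^sup>+)"
    by (auto simp: equiv_def refl_on_def)
  then show ?thesis
    unfolding components_def by (rule partition_on_quotient)
qed

text \<open>Labellings compatible with a family of overlapping blocks are the same as labellings compatible with
its components, because equality of labels is transitive.\<close>

lemma constant_on_components_iff:
  "(\<forall>c\<in>components S. \<forall>x\<in>c. \<forall>y\<in>c. f x = f y) \<longleftrightarrow> (\<forall>B\<in>S. \<forall>x\<in>B. \<forall>y\<in>B. f x = f y)"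
proof
  let ?R = "{(x, y). \<exists>B\<in>S. x \<in> B \<and> y \<in> B}"
  show "\<forall>B\<in>S. \<forall>x\<in>B. \<forall>y\<in>B. f x = f y" if *: "\<forall>c\<in>components S. \<forall>x\<in>c. \<forall>y\<in>c. f x = f y"
  proof (intro ballI)
    fix B x y assume "B \<in> S" "x \<in> B" "y \<in> B"
    then have "?R\<^sup>+ `` {x} \<in> components S" "x \<in> ?R\<^sup>+ `` {x}" "y \<in> ?R\<^sup>+ `` {x}"
      by (auto simp: components_def intro!: quotientI r_into_trancl)
    with * show "f x = f y" by blast
  qed
  show "\<forall>c\<in>components S. \<forall>x\<in>c. \<forall>y\<in>c. f x = f y" if *: "\<forall>B\<in>S. \<forall>x\<in>B. \<forall>y\<in>B. f x = f y"
  proof (intro ballI)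
    have R: "f x = f y" if "(x, y) \<in> ?R\<^sup>+" for x y
      using that by induction (use * in auto)
    fix c x y assume "c \<in> components S" "x \<in> c" "y \<in> c"
    then obtain z where "(z, x) \<in> ?R\<^sup>+" "(z, y) \<in> ?R\<^sup>+"
      by (auto simp: components_def quotient_def)
    then have "f z = f x" "f z = f y" by (auto dest: R)
    then show "f x = f y" by simp
  qed
qed

text \<open>Horizontal and vertical composition, reflection and the count of compatible labellings are all
controlled by the set of points that the blocks exhaust, and this set is easy to follow through
compositions.\<close>

definition covers :: "nat \<Rightarrow> nat \<Rightarrow> part \<Rightarrow> bool" where
  "covers k l p \<longleftrightarrow> \<Union>p = Inl ` {..<k} \<union> Inr ` {..<l}"

lemma covers_parts: "p \<in> parts k l \<Longrightarrow> covers k l p"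
  unfolding parts_def covers_def by (simp add: partition_onD1[symmetric])

lemma Union_glued_components:
  assumes "covers k l p" "covers l m q"
  shows "\<Union>(glued_components q p) = Inl ` {..<k} \<union> (Inr \<circ> Inl) ` {..<l} \<union> (Inr \<circ> Inr) ` {..<m}"
proof -
  have "\<Union>(glued_components q p) = map_sum id Inl ` (\<Union>p) \<union> Inr ` (\<Union>q)"
    unfolding glued_components_def partition_onD1[OF partition_on_components, symmetric] by auto
  also have "\<dots> = Inl ` {..<k} \<union> (Inr \<circ> Inl) ` {..<l} \<union> (Inr \<circ> Inr) ` {..<m}"
    using assms unfolding covers_def by (simp add: image_Un image_image Un_assoc)
  finally show ?thesis .
qed

lemma partition_on_glued_components:
  "partition_on (\<Union>(glued_components q p)) (glued_components q p)"
  unfolding glued_components_def partition_onD1[OF partition_on_components, symmetric]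
  by (rule partition_on_components)

abbreviation label3 :: "mind \<Rightarrow> mind \<Rightarrow> mind \<Rightarrow> nat + nat + nat \<Rightarrow> nat" where
  "label3 i j m \<equiv> case_sum (nth i) (case_sum (nth j) (nth m))"

lemma delta_glued_iff:
  "delta p i j \<and> delta q j m \<longleftrightarrow>
     (\<forall>c\<in>glued_components q p. \<forall>x\<in>c. \<forall>y\<in>c. label3 i j m x = label3 i j m y)"
proof -
  have p: "label3 i j m (map_sum id Inl x) = case_sum (nth i) (nth j) x" for x
    by (cases x) auto
  have "(\<forall>c\<in>glued_components q p. \<forall>x\<in>c. \<forall>y\<in>c. label3 i j m x = label3 i j m y) \<longleftrightarrow>
    (\<forall>B\<in>p. \<forall>x\<in>B. \<forall>y\<in>B. label3 i j m (map_sum id Inl x) = label3 i j m (map_sum id Inl y)) \<and>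
    (\<forall>B\<in>q. \<forall>x\<in>B. \<forall>y\<in>B. label3 i j m (Inr x) = label3 i j m (Inr y))"
    unfolding glued_components_def
    by (subst constant_on_components_iff) (simp only: ball_Un ball_simps)
  then show ?thesis
    by (simp only: delta_def p sum.case)
qed

text \<open>The labels \<open>j\<close> of the middle row are a free parameter: the points outside the middle row do not look
at them.\<close>

lemma delta_vcat_iff:
  "delta (vcat q p) i m \<longleftrightarrow>
     (\<forall>c\<in>glued_components q p. \<forall>x\<in>c - range (Inr \<circ> Inl). \<forall>y\<in>c - range (Inr \<circ> Inl).
        label3 i j m x = label3 i j m y)"
proof -
  have outer: "x \<in> c - range (Inr \<circ> Inl) \<longleftrightarrow> (\<exists>y. map_sum id Inr y \<in> c \<and> x = map_sum id Inr y)"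
    for x and c :: "(nat + nat + nat) set"
  proof
    assume x: "x \<in> c - range (Inr \<circ> Inl)"
    show "\<exists>y. map_sum id Inr y \<in> c \<and> x = map_sum id Inr y"
    proof (cases x)
      case (Inl a)
      with x show ?thesis by (intro exI[of _ "Inl a"]) simp
    next
      case (Inr z)
      with x show ?thesis by (cases z) (auto intro!: exI[of _ "Inr _"])
    qed
  next
    assume "\<exists>y. map_sum id Inr y \<in> c \<and> x = map_sum id Inr y"
    then obtain y where "map_sum id Inr y \<in> c" "x = map_sum id Inr y" by blast
    then show "x \<in> c - range (Inr \<circ> Inl)" by (cases y) auto
  qed
  have lab: "label3 i j m (map_sum id Inr y) = case_sum (nth i) (nth m) y" for y
    by (cases y) auto
  have "delta (vcat q p) i m \<longleftrightarrow> (\<forall>c\<in>glued_components q p. \<forall>x y. map_sum id Inr x \<in> c \<longrightarrow>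
      map_sum id Inr y \<in> c \<longrightarrow> case_sum (nth i) (nth m) x = case_sum (nth i) (nth m) y)"
    (is "_ = ?R")
  proof
    assume *: "delta (vcat q p) i m"
    show ?R
    proof (intro ballI allI impI)
      fix c x y
      assume "c \<in> glued_components q p" "map_sum id Inr x \<in> c" "map_sum id Inr y \<in> c"
      moreover from this have "map_sum id Inr -` c \<in> vcat q p"
        unfolding vcat_def by (intro DiffI CollectI exI[of _ c]) auto
      ultimately show "case_sum (nth i) (nth m) x = case_sum (nth i) (nth m) y"
        using *[unfolded delta_def, rule_format, of "map_sum id Inr -` c" x y] by simp
    qed
  next
    assume *: ?R
    show "delta (vcat q p) i m"
      unfolding delta_def
    proof (intro ballI)
      fix B x y assume B: "B \<in> vcat q p" "x \<in> B" "y \<in> B"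
      then obtain c where "c \<in> glued_components q p" "B = map_sum id Inr -` c"
        unfolding vcat_def by blast
      with B(2,3) show "case_sum (nth i) (nth m) x = case_sum (nth i) (nth m) y"
        using *[rule_format, of c x y] by simp
    qed
  qed
  also have "\<dots> \<longleftrightarrow> (\<forall>c\<in>glued_components q p. \<forall>x\<in>c - range (Inr \<circ> Inl).
      \<forall>y\<in>c - range (Inr \<circ> Inl). label3 i j m x = label3 i j m y)"
    unfolding Ball_def outer using lab by (metis (no_types, lifting))
  finally show ?thesis .
qed

lemma delta_vcat_if_delta:
  assumes "delta p i j" "delta q j m"
  shows "delta (vcat q p) i m"
  unfolding delta_vcat_iff[of q p i m j]
proof (intro ballI)
  fix c x y
  assume "c \<in> glued_components q p" "x \<in> c - range (Inr \<circ> Inl)" "y \<in> c - range (Inr \<circ> Inl)"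
  then show "label3 i j m x = label3 i j m y"
    using conjI[OF assms, unfolded delta_glued_iff, rule_format, of c x y] by blast
qed

lemma finite_idx: "finite (idx N n)"
  unfolding idx_def using finite_lists_length_eq[of "{1..N}" n]
  by (simp add: conj_commute)

lemma idx_nth: "j \<in> idx N n \<Longrightarrow> t < n \<Longrightarrow> j ! t \<in> {1..N}"
  unfolding idx_def using nth_mem[of t j] by (auto simp: subset_iff)

text \<open>The two compatibility conditions together say that the labelling of the three rows is constant on
every glued component. A component that meets an outer row has its label prescribed by \<open>i\<close> and \<open>w\<close>,
without contradiction exactly if \<open>i\<close> and \<open>w\<close> are compatible with \<open>vcat q p\<close>; a loop may carry any of
the \<open>N\<close> labels.\<close>

lemma card_middle_labellings:
  assumes p: "covers k l p" and q: "covers l m q" and N: "N > 0"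
    and i: "i \<in> idx N k" and w: "w \<in> idx N m"
  shows "card {j \<in> idx N l. delta p i j \<and> delta q j w} =
    (if delta (vcat q p) i w then N ^ rl q p else 0)"
proof (cases "delta (vcat q p) i w")
  case False
  then have "{j \<in> idx N l. delta p i j \<and> delta q j w} = {}"
    using delta_vcat_if_delta by blast
  then have "card {j \<in> idx N l. delta p i j \<and> delta q j w} = 0"
    by (simp only: card.empty)
  with False show ?thesis by simp
next
  case True
  let ?Q = "glued_components q p"
  let ?M = "range (Inr \<circ> Inl) :: (nat + nat + nat) set"
  let ?J = "{j \<in> idx N l. delta p i j \<and> delta q j w}"
  define L where "L = {c \<in> ?Q. c \<subseteq> ?M}"
  \<comment> \<open>A labelling is determined by the labels of the loops.\<close>
  define \<Phi> where "\<Phi> = (\<lambda>j. \<lambda>c\<in>L. label3 i j w (SOME x. x \<in> c))"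
  note part = partition_on_glued_components[of q p]
  note U = Union_glued_components[OF p q]
  have ne: "c \<noteq> {}" if "c \<in> ?Q" for c
    using partition_onD3[OF part] that by auto
  have some: "(SOME x. x \<in> c) \<in> c" if "c \<in> ?Q" for c
    using ne[OF that] by (simp add: some_in_eq)
  have same: "c = d" if "c \<in> ?Q" "d \<in> ?Q" "x \<in> c" "x \<in> d" for c d x
    using partition_onD2[OF part] that by (auto simp: disjoint_def)
  have "\<exists>c\<in>?Q. Inr (Inl t) \<in> c" if "t < l" for t
  proof -
    have "Inr (Inl t) \<in> \<Union>?Q" unfolding U using that by auto
    then show ?thesis by blast
  qed
  then obtain cl where cl: "\<And>t. t < l \<Longrightarrow> cl t \<in> ?Q" "\<And>t. t < l \<Longrightarrow> Inr (Inl t) \<in> cl t"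
    by metis
  have mid: "\<exists>t<l. x = Inr (Inl t)" if "x \<in> c" "c \<in> ?Q" "x \<in> ?M" for x c
  proof -
    have "x \<in> \<Union>?Q" using that by blast
    then show ?thesis using that(3) unfolding U by auto
  qed
  have outer: "\<exists>x. x \<in> c - ?M" if "c \<in> ?Q" "c \<notin> L" for c
    using that unfolding L_def by blast
  have outer_lab: "label3 i j w x = label3 i j' w x" if "x \<notin> ?M" for x j j'
  proof (cases x)
    case (Inr y)
    with that show ?thesis by (cases y) auto
  qed auto
  have lab_in: "label3 i j w x \<in> {1..N}" if "x \<in> c" "c \<in> ?Q" "j \<in> idx N l" for x c j
  proof -
    have "x \<in> \<Union>?Q" using that by blast
    then show ?thesis unfolding U using idx_nth[OF i] idx_nth[OF w] idx_nth[OF that(3)] by auto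
  qed
  have "bij_betw \<Phi> ?J (L \<rightarrow>\<^sub>E {1..N})"
    unfolding bij_betw_def
  proof
    show "inj_on \<Phi> ?J"
    proof (rule inj_onI)
      fix j j' assume j: "j \<in> ?J" "j' \<in> ?J" and eq: "\<Phi> j = \<Phi> j'"
      have c1: "\<And>c x y. c \<in> ?Q \<Longrightarrow> x \<in> c \<Longrightarrow> y \<in> c \<Longrightarrow> label3 i j w x = label3 i j w y"
        and c2: "\<And>c x y. c \<in> ?Q \<Longrightarrow> x \<in> c \<Longrightarrow> y \<in> c \<Longrightarrow> label3 i j' w x = label3 i j' w y"
        using j delta_glued_iff[of p i j q w] delta_glued_iff[of p i j' q w] by blast+
      have "j ! t = j' ! t" if t: "t < l" for t
      proof -
        have "\<exists>x\<in>cl t. label3 i j w x = label3 i j' w x"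
        proof (cases "cl t \<in> L")
          case True
          then have "label3 i j w (SOME x. x \<in> cl t) = label3 i j' w (SOME x. x \<in> cl t)"
            using fun_cong[OF eq, of "cl t"] unfolding \<Phi>_def by simp
          then show ?thesis using some[OF cl(1)[OF t]] by blast
        next
          case False
          then show ?thesis using outer[OF cl(1)[OF t]] outer_lab by blast
        qed
        then obtain x where "x \<in> cl t" "label3 i j w x = label3 i j' w x" by blast
        then have "label3 i j w (Inr (Inl t)) = label3 i j' w (Inr (Inl t))"
          using c1[OF cl(1)[OF t] cl(2)[OF t]] c2[OF cl(1)[OF t] cl(2)[OF t]] by metis
        then show ?thesis by simp
      qed
      then show "j = j'"
        using j unfolding idx_def by (auto intro!: nth_equalityI)
    qed
    show "\<Phi> ` ?J = L \<rightarrow>\<^sub>E {1..N}"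
    proof
      show "\<Phi> ` ?J \<subseteq> L \<rightarrow>\<^sub>E {1..N}"
      proof (rule image_subsetI)
        fix j assume "j \<in> ?J"
        then have "label3 i j w (SOME x. x \<in> c) \<in> {1..N}" if "c \<in> L" for c
          using that unfolding L_def by (intro lab_in[OF some]) auto
        then show "\<Phi> j \<in> L \<rightarrow>\<^sub>E {1..N}"
          unfolding \<Phi>_def restrict_PiE_iff by blast
      qed
      show "L \<rightarrow>\<^sub>E {1..N} \<subseteq> \<Phi> ` ?J"
      proof
        fix g assume g: "g \<in> L \<rightarrow>\<^sub>E {1..N}"
        \<comment> \<open>The label of a component: chosen by \<open>g\<close> on a loop, read off at an outer
          point otherwise, where the empty list stands for a middle row that is never looked at.\<close>
        define h where "h = (\<lambda>c. if c \<in> L then g c else label3 i [] w (SOME x. x \<in> c - ?M))"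
        define j where "j = map (\<lambda>t. h (cl t)) [0..<l]"
        have h_outer: "h c = label3 i j w x" if c: "c \<in> ?Q" and x: "x \<in> c - ?M" for c x
        proof -
          have "(SOME x. x \<in> c - ?M) \<in> c - ?M" using x by (rule someI)
          moreover have "c \<notin> L" using x unfolding L_def by blast
          moreover have "x \<notin> ?M" using x by blast
          ultimately show ?thesis
            using True[unfolded delta_vcat_iff[of q p i w "[]"], rule_format, OF c x, of "SOME x. x \<in> c - ?M"]
              outer_lab[of x j "[]"]
            unfolding h_def by argo
        qed
        have h: "label3 i j w x = h c" if c: "c \<in> ?Q" and x: "x \<in> c" for c x
        proof (cases "x \<in> ?M")
          case True
          then obtain t where t: "t < l" "x = Inr (Inl t)" using mid[OF x c] by blast
          then have "cl t = c" using same[OF cl(1) c cl(2)] x by blast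
          then show ?thesis using t unfolding j_def by simp
        next
          case False
          then show ?thesis using h_outer[OF c, of x] x by simp
        qed
        have h_in: "h c \<in> {1..N}" if c: "c \<in> ?Q" for c
        proof (cases "c \<in> L")
          case True
          then show ?thesis using g unfolding h_def by auto
        next
          case False
          then obtain x where x: "x \<in> c - ?M" using outer[OF c] by blast
          have "replicate l 1 \<in> idx N l" using N unfolding idx_def by (auto simp: set_replicate_conv_if)
          then have "label3 i (replicate l 1) w x \<in> {1..N}" using lab_in[OF _ c] x by blast
          then show ?thesis using h_outer[OF c x] outer_lab[of x "replicate l 1" j] x by simp
        qed
        have "j \<in> idx N l"
          using h_in cl(1) unfolding j_def idx_def by fastforce
        moreover have "delta p i j \<and> delta q j w"
          unfolding delta_glued_iff
        proof (intro ballI)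
          fix c x y assume "c \<in> ?Q" "x \<in> c" "y \<in> c"
          then show "label3 i j w x = label3 i j w y" using h[of c x] h[of c y] by simp
        qed
        moreover have "\<Phi> j = g"
        proof
          fix c show "\<Phi> j c = g c"
          proof (cases "c \<in> L")
            case True
            then have "c \<in> ?Q" unfolding L_def by blast
            then have "label3 i j w (SOME x. x \<in> c) = h c" using h some by blast
            with True show ?thesis unfolding \<Phi>_def h_def by simp
          next
            case False
            then show ?thesis using PiE_arb[OF g False] unfolding \<Phi>_def by simp
          qed
        qed
        ultimately show "g \<in> \<Phi> ` ?J" by blast
      qed
    qed
  qed
  then have "card ?J = card (L \<rightarrow>\<^sub>E {1..N})" by (rule bij_betw_same_card)
  moreover have "finite L"
  proof -
    have "finite (\<Union>?Q)" unfolding U by simp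
    then have "finite ?Q" using part by (rule finite_elements)
    then show ?thesis unfolding L_def by simp
  qed
  ultimately show ?thesis using True unfolding rl_def L_def[symmetric] by (simp add: card_PiE)
qed

text \<open>Forgetting the number of loops, composition of partitions becomes composition of the compatibility
relations.\<close>

lemma delta_vcat:
  assumes "covers k l p" "covers l m q" "N > 0" "i \<in> idx N k" "w \<in> idx N m"
  shows "delta (vcat q p) i w \<longleftrightarrow> (\<exists>j\<in>idx N l. delta p i j \<and> delta q j w)"
proof -
  have "delta (vcat q p) i w \<longleftrightarrow> card {j \<in> idx N l. delta p i j \<and> delta q j w} \<noteq> 0"
    using card_middle_labellings[OF assms] \<open>N > 0\<close> by auto
  also have "\<dots> \<longleftrightarrow> (\<exists>j\<in>idx N l. delta p i j \<and> delta q j w)"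
    using finite_idx by auto
  finally show ?thesis .
qed

section \<open>Coverings\<close>

lemma covers_vcat:
  assumes "covers k l p" "covers l m q"
  shows "covers k m (vcat q p)"
proof -
  have "\<Union>(vcat q p) = map_sum id Inr -` \<Union>(glued_components q p)"
    unfolding vcat_def by auto
  also have "\<dots> = Inl ` {..<k} \<union> Inr ` {..<m}"
    unfolding Union_glued_components[OF assms]
  proof (rule Set.set_eqI)
    fix x :: "nat + nat"
    show "x \<in> map_sum id Inr -` (Inl ` {..<k} \<union> (Inr \<circ> Inl) ` {..<l} \<union> (Inr \<circ> Inr) ` {..<m})
      \<longleftrightarrow> x \<in> Inl ` {..<k} \<union> Inr ` {..<m}"
      by (cases x) auto
  qed
  finally show ?thesis unfolding covers_def .
qed

lemma covers_hcat:
  assumes "covers k l p" "covers m n q"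
  shows "covers (k + m) (l + n) (hcat k l p q)"
proof -
  have shift: "{..<a} \<union> (\<lambda>i. a + i) ` {..<b} = {..<a + b}" for a b :: nat
    using image_add_atLeastLessThan[of a 0 b] by (auto simp: lessThan_atLeast0)
  have "\<Union>(hcat k l p q) = \<Union>p \<union> map_sum (\<lambda>i. k + i) (\<lambda>j. l + j) ` \<Union>q"
    unfolding hcat_def by (simp add: image_Union)
  also have "\<dots> = Inl ` ({..<k} \<union> (\<lambda>i. k + i) ` {..<m}) \<union> Inr ` ({..<l} \<union> (\<lambda>i. l + i) ` {..<n})"
    using assms unfolding covers_def by (simp add: image_Un image_image Un_ac)
  finally show ?thesis unfolding covers_def shift .
qed

lemma covers_pstar: "covers k l p \<Longrightarrow> covers l k (pstar p)"
proof -
  assume "covers k l p"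
  moreover have "\<Union>(pstar p) = case_sum Inr Inl ` \<Union>p"
    unfolding pstar_def by (simp add: image_Union)
  ultimately show ?thesis
    unfolding covers_def by (simp add: image_Un image_image Un_commute)
qed

lemma covers_id_part: "covers n n (id_part n)"
  unfolding covers_def id_part_def setcompr_eq_image by auto

lemma covers_nested_pairs: "covers 0 (2 * m) (nested_pairs m)"
proof -
  have "\<exists>i<m. j = i \<or> j = 2 * m - 1 - i" if "j < 2 * m" for j
  proof (cases "j < m")
    case False
    with that show ?thesis by (intro exI[of _ "2 * m - 1 - j"]) auto
  qed auto
  then show ?thesis
    unfolding covers_def nested_pairs_def setcompr_eq_image by fastforce
qed

lemma covers_pair_part: "covers 0 2 pair_part"
  unfolding covers_def pair_part_def by auto

section \<open>Compatible multi-indices\<close>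

lemma delta_hcat:
  assumes p: "covers k l p" and "k \<le> length i" "l \<le> length j"
  shows "delta (hcat k l p q) i j \<longleftrightarrow>
    delta p (take k i) (take l j) \<and> delta q (drop k i) (drop l j)"
proof -
  have left: "case_sum (nth (take k i)) (nth (take l j)) x = case_sum (nth i) (nth j) x"
    if "B \<in> p" "x \<in> B" for B x
  proof -
    have "x \<in> \<Union>p" using that by blast
    then show ?thesis using p unfolding covers_def by auto
  qed
  have right: "case_sum (nth i) (nth j) (map_sum (\<lambda>i. k + i) (\<lambda>j. l + j) x) =
      case_sum (nth (drop k i)) (nth (drop l j)) x" for x
    using assms by (cases x) auto
  have "delta p (take k i) (take l j) \<longleftrightarrow> delta p i j"
    unfolding delta_def by (intro ball_cong refl) (simp only: left)
  then show ?thesis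
    unfolding hcat_def by (simp only: delta_def ball_Un ball_simps right)
qed

lemma delta_pstar: "delta (pstar p) i j \<longleftrightarrow> delta p j i"
proof -
  have flip: "case_sum (nth i) (nth j) (case_sum Inr Inl x) = case_sum (nth j) (nth i) x" for x
    by (cases x) auto
  show ?thesis
    unfolding pstar_def by (simp only: delta_def ball_simps flip)
qed

lemma delta_id_part:
  assumes "length i = n" "length j = n"
  shows "delta (id_part n) i j \<longleftrightarrow> i = j"
proof -
  have "delta (id_part n) i j \<longleftrightarrow> (\<forall>t<n. i ! t = j ! t)"
    unfolding delta_def id_part_def setcompr_eq_image by auto
  then show ?thesis
    using assms by (auto simp: list_eq_iff_nth_eq)
qed

lemma delta_pair_part: "delta pair_part i j \<longleftrightarrow> j ! 0 = j ! 1"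
  unfolding delta_def pair_part_def by auto

lemma delta_nested_pairs:
  assumes "length j = 2 * m"
  shows "delta (nested_pairs m) i j \<longleftrightarrow> drop m j = rev (take m j)"
proof -
  have "delta (nested_pairs m) i j \<longleftrightarrow> (\<forall>t<m. j ! t = j ! (2 * m - 1 - t))"
    unfolding delta_def nested_pairs_def setcompr_eq_image by auto
  also have "\<dots> \<longleftrightarrow> rev (drop m j) = take m j"
    using assms by (auto simp: list_eq_iff_nth_eq rev_nth mult_2)
  also have "\<dots> \<longleftrightarrow> drop m j = rev (take m j)"
    using rev_swap by blast
  finally show ?thesis .
qed

lemma idx_length: "i \<in> idx N n \<Longrightarrow> length i = n"
  by (simp add: idx_def)

lemma idx_append: "length i = k \<Longrightarrow> i @ j \<in> idx N (k + l) \<longleftrightarrow> i \<in> idx N k \<and> j \<in> idx N l"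
  by (auto simp: idx_def)

lemma idx_rev: "rev i \<in> idx N n \<longleftrightarrow> i \<in> idx N n"
  by (auto simp: idx_def)

lemma idx_add_iff: "i \<in> idx N (k + l) \<longleftrightarrow> take k i \<in> idx N k \<and> drop k i \<in> idx N l"
proof (cases "k \<le> length i")
  case True
  then show ?thesis using idx_append[of "take k i" k "drop k i" N l] by simp
next
  case False
  then show ?thesis by (simp add: idx_def)
qed

lemma idx_ones: "N > 0 \<Longrightarrow> replicate n 1 \<in> idx N n"
  by (auto simp: idx_def)

lemma covers_pbar_factors:
  assumes "covers m m p"
  shows "covers m (3 * m) (hcat m m (id_part m) (nested_pairs m))"
    and "covers (3 * m) (3 * m) (hcat (m + m) (m + m) (hcat m m (id_part m) p) (id_part m))"
    and "covers (3 * m) m (hcat (2 * m) 0 (pstar (nested_pairs m)) (id_part m))"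
proof -
  show "covers m (3 * m) (hcat m m (id_part m) (nested_pairs m))"
    using covers_hcat[OF covers_id_part[of m] covers_nested_pairs[of m]] by simp
  show "covers (3 * m) (3 * m) (hcat (m + m) (m + m) (hcat m m (id_part m) p) (id_part m))"
    using covers_hcat[OF covers_hcat[OF covers_id_part[of m] assms] covers_id_part[of m]]
    by (simp add: numeral_3_eq_3 ac_simps)
  show "covers (3 * m) m (hcat (2 * m) 0 (pstar (nested_pairs m)) (id_part m))"
    using covers_hcat[OF covers_pstar[OF covers_nested_pairs[of m]] covers_id_part[of m]] by simp
qed

text \<open>The factor of the rotation applied first turns \<open>i\<close> into \<open>i @ y @ rev y\<close> with an arbitrary \<open>y\<close>, the next one
applies \<open>p\<close> to the middle part \<open>y\<close>, and the last one forces the result to be \<open>rev i\<close> and outputs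
\<open>rev y\<close>.\<close>

lemma delta_pbar:
  assumes p: "covers m m p" and N: "N > 0" and i: "i \<in> idx N m" and w: "w \<in> idx N m"
  shows "delta (pbar m p) i w \<longleftrightarrow> delta p (rev w) (rev i)"
proof -
  let ?A = "hcat m m (id_part m) (nested_pairs m)"
  let ?B = "hcat (m + m) (m + m) (hcat m m (id_part m) p) (id_part m)"
  let ?C = "hcat (2 * m) 0 (pstar (nested_pairs m)) (id_part m)"
  note cov = covers_pbar_factors[OF p]
  have li: "length i = m" and lw: "length w = m" using i w by (auto simp: idx_length)
  have A: "delta ?A i (x @ y @ z) \<longleftrightarrow> x = i \<and> z = rev y"
    if "length x = m" "length y = m" "length z = m" for x y z
    using that li by (auto simp: delta_hcat[OF covers_id_part] delta_id_part delta_nested_pairs)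
  have B: "delta ?B (x @ y @ z) (x' @ y' @ z') \<longleftrightarrow> x = x' \<and> delta p y y' \<and> z = z'"
    if "length x = m" "length y = m" "length z = m" "length x' = m" "length y' = m" "length z' = m"
    for x y z x' y' z'
    using that by (simp add: delta_hcat[OF covers_hcat[OF covers_id_part[of m] p]]
        delta_hcat[OF covers_id_part] delta_id_part)
  have C: "delta ?C (x @ y @ z) w \<longleftrightarrow> y = rev x \<and> z = w"
    if "length x = m" "length y = m" "length z = m" for x y z
    using that lw by (simp add: delta_hcat[OF covers_pstar[OF covers_nested_pairs]] delta_id_part
        delta_pstar delta_nested_pairs)
  have split: "\<exists>x y z. b = x @ y @ z \<and> length x = m \<and> length y = m \<and> length z = m"
    if "b \<in> idx N (3 * m)" for b
  proof (intro exI conjI)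
    show "b = take m b @ take m (drop m b) @ drop m (drop m b)"
      by (simp only: append_take_drop_id)
  qed (use idx_length[OF that] in simp_all)
  have join: "x @ y @ z \<in> idx N (3 * m)" if "x \<in> idx N m" "y \<in> idx N m" "z \<in> idx N m" for x y z
    using that by (auto simp: idx_def)
  have AB: "delta (vcat ?B ?A) i b \<longleftrightarrow> (\<exists>a\<in>idx N (3 * m). delta ?A i a \<and> delta ?B a b)"
    if "b \<in> idx N (3 * m)" for b
    by (rule delta_vcat[OF cov(1,2) N i that])
  have "delta (pbar m p) i w \<longleftrightarrow> (\<exists>b\<in>idx N (3 * m). delta (vcat ?B ?A) i b \<and> delta ?C b w)"
    unfolding pbar_def by (rule delta_vcat[OF covers_vcat[OF cov(1,2)] cov(3) N i w])
  also have "\<dots> \<longleftrightarrow> delta p (rev w) (rev i)"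
  proof
    assume "\<exists>b\<in>idx N (3 * m). delta (vcat ?B ?A) i b \<and> delta ?C b w"
    then obtain a b where ab: "a \<in> idx N (3 * m)" "b \<in> idx N (3 * m)"
      and d: "delta ?A i a" "delta ?B a b" "delta ?C b w"
      using AB by blast
    obtain x y z where a: "a = x @ y @ z" "length x = m" "length y = m" "length z = m"
      using split[OF ab(1)] by blast
    obtain x' y' z' where b: "b = x' @ y' @ z'" "length x' = m" "length y' = m" "length z' = m"
      using split[OF ab(2)] by blast
    have "x = i" "z = rev y" using A[OF a(2-4)] d(1) a(1) by auto
    moreover have "x = x'" "delta p y y'" "z = z'" using B[OF a(2-4) b(2-4)] d(2) a(1) b(1) by auto
    moreover have "y' = rev x'" "z' = w" using C[OF b(2-4)] d(3) b(1) by auto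
    ultimately show "delta p (rev w) (rev i)" by auto
  next
    assume *: "delta p (rev w) (rev i)"
    have a: "i @ rev w @ w \<in> idx N (3 * m)" and b: "i @ rev i @ w \<in> idx N (3 * m)"
      using i w by (auto intro: join simp: idx_rev)
    have "delta (vcat ?B ?A) i (i @ rev i @ w)"
      unfolding AB[OF b] using A[of i "rev w" w] B[of i "rev w" w i "rev i" w] * li lw
      by (intro bexI[OF _ a]) simp
    moreover have "delta ?C (i @ rev i @ w) w" using C[of i "rev i" w] li lw by simp
    ultimately show "\<exists>b\<in>idx N (3 * m). delta (vcat ?B ?A) i b \<and> delta ?C b w"
      using b by blast
  qed
  finally show ?thesis .
qed

section \<open>The vectors of projective partitions\<close>

lemma projective_covers: "projective_partition k p \<Longrightarrow> covers k k p"
  by (simp add: projective_partition_def covers_parts)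

lemma projective_delta_sym: "projective_partition k p \<Longrightarrow> delta p a b \<longleftrightarrow> delta p b a"
  using delta_pstar[of p a b] by (simp add: projective_partition_def)

lemma eta_eq:
  assumes "N > 0"
  shows "eta N n p = (\<lambda>j. if j \<in> idx N n \<and> delta p (replicate n 1) j then 1 else 0)"
proof
  fix j
  have "eta N n p j = (\<Sum>i\<in>idx N n. if i = replicate n 1 then T_part N n n p (j, i) else 0)"
    unfolding eta_def mat_apply_def e1_pow_def by (intro sum.cong) auto
  also have "\<dots> = T_part N n n p (j, replicate n 1)"
    using idx_ones[OF assms, of n] by (simp add: finite_idx)
  finally show "eta N n p j = (if j \<in> idx N n \<and> delta p (replicate n 1) j then 1 else 0)"
    using idx_ones[OF assms, of n] by (simp add: T_part_def)
qed

lemma eta_hcat: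
  assumes N: "N > 0" and p: "covers k k p"
  shows "eta N (k + l) (hcat k k p q) w = eta N k p (take k w) * eta N l q (drop k w)"
proof (cases "w \<in> idx N (k + l)")
  case True
  then have "length w = k + l" by (rule idx_length)
  then have "delta (hcat k k p q) (replicate (k + l) 1) w \<longleftrightarrow>
      delta p (replicate k 1) (take k w) \<and> delta q (replicate l 1) (drop k w)"
    using delta_hcat[OF p, of "replicate (k + l) 1" w q] by simp
  then show ?thesis
    using True idx_add_iff[of w N k l] by (simp add: eta_eq[OF N])
next
  case False
  then show ?thesis
    using idx_add_iff[of w N k l] by (auto simp: eta_eq[OF N])
qed

text \<open>The rotation exchanges the two rows of \<open>p\<close> and reverses them; the reflection symmetry of \<open>p\<close> exchanges
the rows back.\<close>

lemma eta_pbar: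
  assumes N: "N > 0" and p: "projective_partition m p"
  shows "eta N m (pbar m p) w = eta N m p (rev w)"
  using delta_pbar[OF projective_covers[OF p] N idx_ones[OF N, of m], of w]
    projective_delta_sym[OF p, of "rev w" "replicate m 1"]
  by (auto simp: eta_eq[OF N] idx_rev)

text \<open>The two middle rows of \<open>rpr*\<close> can be combined by any binary operation on the labels which is 1 on the
diagonal and returns the second argument when the first is 1.\<close>

definition one_if_equal :: "nat \<Rightarrow> nat \<Rightarrow> nat" where
  "one_if_equal c x = (if c = x then 1 else x)"

text \<open>Expand \<open>p\<close> to \<open>pp\<close> and let \<open>c\<close> be a labelling of the middle row. By the symmetry of \<open>p\<close> both \<open>a\<close> at the
point \<open>x\<close> and \<open>b\<close> at the point \<open>x\<close> equal the label of \<open>c\<close> at the upper end of the through-block.\<close>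

lemma projective_through_eq:
  assumes p: "projective_partition k p" and N: "N > 0" and a: "a \<in> idx N k" and b: "b \<in> idx N k"
    and d: "delta p a b" and B: "B \<in> p" "Inl u \<in> B" "Inr x \<in> B"
  shows "a ! x = b ! x"
proof -
  note cov = projective_covers[OF p]
  have "delta (vcat p p) a b" using d p by (simp add: projective_partition_def)
  then obtain c where c: "delta p a c" "delta p c b"
    using delta_vcat[OF cov cov N a b] by blast
  then have "c ! u = b ! x" using B unfolding delta_def by fastforce
  moreover have "delta p c a" using c(1) projective_delta_sym[OF p] by blast
  then have "c ! u = a ! x" using B unfolding delta_def by fastforce
  ultimately show ?thesis by simp
qed

text \<open>On a through-block \<open>a\<close> and \<open>b\<close> agree, so the combined label is 1, as on the upper row; on a block
inside the lower row \<open>b\<close> is constant, and by symmetry of \<open>p\<close> so is \<open>a\<close>.\<close>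

lemma delta_one_if_equal_projective:
  assumes p: "projective_partition k p" and N: "N > 0" and a: "a \<in> idx N k" and b: "b \<in> idx N k"
    and d: "delta p a b"
  shows "delta p (replicate k 1) (map2 one_if_equal a b)"
  unfolding delta_def
proof (intro ballI)
  fix B x y assume B: "B \<in> p" "x \<in> B" "y \<in> B"
  let ?f = "case_sum (nth (replicate k 1)) (nth (map2 one_if_equal a b))"
  have in_range: "z \<in> Inl ` {..<k} \<union> Inr ` {..<k}" if "z \<in> B" for z
    using projective_covers[OF p] B(1) that unfolding covers_def by blast
  have len: "length a = k" "length b = k" using a b by (auto simp: idx_length)
  have through: "?f z = 1" if "z \<in> B" "Inl u \<in> B" for z u
    using in_range[OF that(1)] projective_through_eq[OF p N a b d B(1) that(2)] that(1) len
    by (auto simp: one_if_equal_def)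
  show "?f x = ?f y"
  proof (cases "\<exists>u. Inl u \<in> B")
    case True
    then show ?thesis using through B by metis
  next
    case False
    then obtain s t where st: "x = Inr s" "y = Inr t" "s < k" "t < k"
      using in_range[OF B(2)] in_range[OF B(3)] B(2,3) by blast
    have "b ! s = b ! t" using d B st unfolding delta_def by fastforce
    moreover have "delta p b a" using d projective_delta_sym[OF p] by blast
    then have "a ! s = a ! t" using B st unfolding delta_def by fastforce
    ultimately show ?thesis using st len by simp
  qed
qed

text \<open>Both \<open>(a, 1)\<close> and \<open>(b, w)\<close> are constant on the blocks of \<open>r\<close>, hence so is any function of the two; on
the lower row this function has first argument 1 and returns \<open>w\<close>.\<close>

lemma delta_one_if_equal:
  assumes r: "covers k l r" and a: "a \<in> idx N k" and b: "b \<in> idx N k" and w: "w \<in> idx N l"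
    and da: "delta r a (replicate l 1)" and db: "delta r b w"
  shows "delta r (map2 one_if_equal a b) w"
  unfolding delta_def
proof (intro ballI)
  fix B x y assume B: "B \<in> r" "x \<in> B" "y \<in> B"
  have len: "length a = k" "length b = k" "length w = l" using a b w by (auto simp: idx_length)
  have f: "case_sum (nth (map2 one_if_equal a b)) (nth w) z =
      one_if_equal (case_sum (nth a) (nth (replicate l 1)) z) (case_sum (nth b) (nth w) z)"
    if "z \<in> B" for z
  proof -
    have "z \<in> Inl ` {..<k} \<union> Inr ` {..<l}" using r B(1) that unfolding covers_def by blast
    then show ?thesis using len by (auto simp: one_if_equal_def)
  qed
  have "case_sum (nth a) (nth (replicate l 1)) x = case_sum (nth a) (nth (replicate l 1)) y"
    "case_sum (nth b) (nth w) x = case_sum (nth b) (nth w) y"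
    using da db B unfolding delta_def by blast+
  then show "case_sum (nth (map2 one_if_equal a b)) (nth w) x = case_sum (nth (map2 one_if_equal a b)) (nth w) y"
    by (simp only: f[OF B(2)] f[OF B(3)])
qed

text \<open>A lower block of \<open>rp\<close> is connected to the upper row of \<open>p\<close> exactly if it is connected to the upper row of
\<open>rpr*\<close>, because a through-block of \<open>p\<close> continues into the mirror image of the part below it. In terms
of labels: from middle rows \<open>a\<close>, \<open>b\<close> of \<open>rpr*\<close> the combined row is a middle row for \<open>rp\<close>, and
conversely the constant row 1 can be used for \<open>a\<close>.\<close>

lemma delta_conjugate:
  assumes r: "covers k l r" and p: "projective_partition k p" and N: "N > 0" and w: "w \<in> idx N l"
  shows "delta (vcat (vcat r p) (pstar r)) (replicate l 1) w \<longleftrightarrow> delta (vcat r p) (replicate k 1) w"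
proof -
  note cp = projective_covers[OF p]
  note vc = delta_vcat[OF cp r N _ w]
  have "delta (vcat (vcat r p) (pstar r)) (replicate l 1) w \<longleftrightarrow>
      (\<exists>a\<in>idx N k. delta r a (replicate l 1) \<and> delta (vcat r p) a w)"
    using delta_vcat[OF covers_pstar[OF r] covers_vcat[OF cp r] N idx_ones[OF N] w]
    by (simp only: delta_pstar)
  also have "\<dots> \<longleftrightarrow> delta (vcat r p) (replicate k 1) w"
  proof
    assume "\<exists>a\<in>idx N k. delta r a (replicate l 1) \<and> delta (vcat r p) a w"
    then obtain a b where ab: "a \<in> idx N k" "b \<in> idx N k"
      and d: "delta r a (replicate l 1)" "delta p a b" "delta r b w"
      using vc by blast
    have "one_if_equal c x \<in> {1..N}" if "x \<in> {1..N}" for c x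
      using that N by (auto simp: one_if_equal_def)
    then have "map2 one_if_equal a b \<in> idx N k"
      using ab unfolding idx_def by (auto simp: subset_iff dest: set_zip_rightD)
    then show "delta (vcat r p) (replicate k 1) w"
      using vc[OF idx_ones[OF N]] delta_one_if_equal_projective[OF p N ab d(2)] delta_one_if_equal[OF r ab w d(1,3)]
      by blast
  next
    assume "delta (vcat r p) (replicate k 1) w"
    moreover have "delta r (replicate k 1) (replicate l 1)"
      unfolding delta_def
    proof (intro ballI)
      have one: "case_sum (nth (replicate k 1)) (nth (replicate l 1)) z = (1::nat)"
        if "z \<in> B" "B \<in> r" for z B
      proof -
        have "z \<in> Inl ` {..<k} \<union> Inr ` {..<l}" using r that unfolding covers_def by blast
        then show ?thesis by auto
      qed
      fix B x y assume "B \<in> r" "x \<in> B" "y \<in> B"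
      then show "case_sum (nth (replicate k 1)) (nth (replicate l 1)) x =
          (case_sum (nth (replicate k 1)) (nth (replicate l 1)) y :: nat)"
        using one by metis
    qed
    ultimately show "\<exists>a\<in>idx N k. delta r a (replicate l 1) \<and> delta (vcat r p) a w"
      using idx_ones[OF N] by blast
  qed
  finally show ?thesis .
qed

lemma T_part_eta:
  assumes r: "covers k l r" and p: "projective_partition k p" and N: "N > 0"
  shows "mat_apply N k (T_part N k l r) (eta N k p) =
    cscale (of_nat N ^ rl r p) (eta N l (vcat (vcat r p) (pstar r)))"
proof
  fix w
  let ?J = "{b \<in> idx N k. delta p (replicate k 1) b \<and> delta r b w}"
  show "mat_apply N k (T_part N k l r) (eta N k p) w =
    cscale (of_nat N ^ rl r p) (eta N l (vcat (vcat r p) (pstar r))) w"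
  proof (cases "w \<in> idx N l")
    case True
    have "mat_apply N k (T_part N k l r) (eta N k p) w = (\<Sum>b\<in>idx N k. if b \<in> ?J then 1 else 0)"
      unfolding mat_apply_def eta_eq[OF N] T_part_def using True by (intro sum.cong) auto
    also have "\<dots> = of_nat (card ?J)"
      by (subst sum.inter_filter[symmetric]) (auto simp: finite_idx intro: arg_cong[where f = card])
    also have "\<dots> = (if delta (vcat r p) (replicate k 1) w then of_nat N ^ rl r p else 0)"
      unfolding card_middle_labellings[OF projective_covers[OF p] r N idx_ones[OF N] True] by simp
    finally show ?thesis
      using True delta_conjugate[OF r p N True] by (simp add: cscale_def eta_eq[OF N])
  next
    case False
    then show ?thesis
      by (simp add: cscale_def eta_eq[OF N] mat_apply_def T_part_def)
  qed
qed

section \<open>Linear algebra of finitely supported functions\<close>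

definition clinear :: "('i cvec \<Rightarrow> 'j cvec) \<Rightarrow> bool" where
  "clinear f \<longleftrightarrow> (\<forall>x y. f (x + y) = f x + f y) \<and> (\<forall>c x. f (cscale c x) = cscale c (f x))"

lemma clinear_add: "clinear f \<Longrightarrow> f (x + y) = f x + f y"
  and clinear_scale: "clinear f \<Longrightarrow> f (cscale c x) = cscale c (f x)"
  by (auto simp: clinear_def)

lemma clinear_zero: "clinear f \<Longrightarrow> f 0 = 0"
  using clinear_scale[of f 0 0] by simp

lemma clinear_diff: "clinear f \<Longrightarrow> f (x - y) = f x - f y"
  using clinear_add[of f "x - y" y] by (simp add: algebra_simps)

lemma subspace_vimage_clinear:
  assumes f: "clinear f" and W: "cvec.subspace W"
  shows "cvec.subspace {x. f x \<in> W}"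
  using clinear_add[OF f] clinear_scale[OF f] clinear_zero[OF f]
    cvec.subspace_0[OF W] cvec.subspace_add[OF W] cvec.subspace_scale[OF W]
  by (intro cvec.subspaceI) (simp_all only: mem_Collect_eq)

lemma subspace_image_clinear:
  assumes f: "clinear f" and V: "cvec.subspace V"
  shows "cvec.subspace (f ` V)"
proof (rule cvec.subspaceI)
  show "0 \<in> f ` V" using clinear_zero[OF f] cvec.subspace_0[OF V] by force
next
  fix x y assume "x \<in> f ` V" "y \<in> f ` V"
  then show "x + y \<in> f ` V"
    using clinear_add[OF f, symmetric] cvec.subspace_add[OF V] by auto
next
  fix c x assume "x \<in> f ` V"
  then show "cscale c x \<in> f ` V"
    using clinear_scale[OF f, symmetric] cvec.subspace_scale[OF V] by auto
qed

lemma linear_map_on_clinear: "clinear f \<Longrightarrow> (\<And>x. x \<in> V \<Longrightarrow> f x \<in> W) \<Longrightarrow> linear_map_on V W f"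
  by (auto simp: linear_map_on_def clinear_def)

lemma cspan_induct:
  assumes "x \<in> cspan S" "cvec.subspace {x. Q x}" "\<And>x. x \<in> S \<Longrightarrow> Q x"
  shows "Q x"
  using cvec.span_minimal[of S "{x. Q x}"] assms by auto

lemma tensor_space_induct:
  assumes "t \<in> tensor_space V W" "cvec.subspace {t. Q t}"
    and "\<And>x y. x \<in> V \<Longrightarrow> y \<in> W \<Longrightarrow> Q (tensor_vec x y)"
  shows "Q t"
  using assms(1)[unfolded tensor_space_def] by (rule cspan_induct) (use assms in auto)

lemma tensor_vec_mem: "x \<in> V \<Longrightarrow> y \<in> W \<Longrightarrow> tensor_vec x y \<in> tensor_space V W"
  unfolding tensor_space_def by (intro cvec.span_base) blast

lemma subspace_tensor_space: "cvec.subspace (tensor_space V W)"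
  unfolding tensor_space_def by (rule cvec.subspace_span)

lemma clinear_tensor_vec_left: "clinear (\<lambda>x. tensor_vec x y)"
  and clinear_tensor_vec_right: "clinear (\<lambda>y. tensor_vec x y)"
  by (auto simp: clinear_def tensor_vec_def cscale_def plus_fun_def algebra_simps)

lemma clinear_compose: "clinear f \<Longrightarrow> clinear g \<Longrightarrow> clinear (\<lambda>x. f (g x))"
  by (simp add: clinear_def)

lemma clinear_mat_apply: "clinear (mat_apply N k T)"
  and clinear_mat_apply_op: "clinear (\<lambda>T. mat_apply N k T x)"
  by (auto simp: clinear_def mat_apply_def cscale_def plus_fun_def algebra_simps sum.distrib
      sum_distrib_left)

lemma clinear_tensor_map:
  assumes f: "clinear f" and g: "clinear g"
  shows "clinear (tensor_map f g)"
proof -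
  have "tensor_map f g (s + t) = tensor_map f g s + tensor_map f g t" for s t
  proof -
    have "(\<lambda>j. f (\<lambda>i. (s + t) (i, j)) i') = (\<lambda>j. f (\<lambda>i. s (i, j)) i') + (\<lambda>j. f (\<lambda>i. t (i, j)) i')" for i'
      using clinear_add[OF f] by (simp add: plus_fun_def fun_eq_iff)
    then show ?thesis
      unfolding tensor_map_def using clinear_add[OF g] by (auto simp: plus_fun_def fun_eq_iff)
  qed
  moreover have "tensor_map f g (cscale c t) = cscale c (tensor_map f g t)" for c t
  proof -
    have "(\<lambda>j. f (\<lambda>i. cscale c t (i, j)) i') = cscale c (\<lambda>j. f (\<lambda>i. t (i, j)) i')" for i'
      using clinear_scale[OF f, of c] by (simp add: cscale_def fun_eq_iff)
    then show ?thesis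
      unfolding tensor_map_def using clinear_scale[OF g, of c] by (auto simp: cscale_def fun_eq_iff)
  qed
  ultimately show ?thesis by (simp add: clinear_def)
qed

lemma clinear_id: "clinear id"
  by (simp add: clinear_def)

text \<open>A slice of \<open>x \<otimes> y\<close> is a multiple of \<open>x\<close>, which homogeneity of \<open>f\<close> pulls out; the same happens once more
for \<open>g\<close>.\<close>

lemma tensor_map_tensor_vec:
  assumes f: "clinear f" and g: "clinear g"
  shows "tensor_map f g (tensor_vec x y) = tensor_vec (f x) (g y)"
proof -
  have "(\<lambda>i. x i * y j) = cscale (y j) x" for j
    by (simp add: cscale_def mult.commute)
  then have "(\<lambda>j. f (\<lambda>i. x i * y j) i') = cscale (f x i') y" for i'
    by (simp add: clinear_scale[OF f]) (simp add: cscale_def mult.commute)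
  then show ?thesis
    unfolding tensor_map_def tensor_vec_def
    by (simp add: clinear_scale[OF g]) (simp add: cscale_def)
qed

definition supported :: "'i set \<Rightarrow> 'i cvec set" where
  "supported S = {x. \<forall>i. i \<notin> S \<longrightarrow> x i = 0}"

lemma subspace_supported: "cvec.subspace (supported S)"
  by (auto simp: cvec.subspace_def supported_def cscale_def)

lemma tensor_space_supported:
  assumes "V \<subseteq> supported A" "W \<subseteq> supported B"
  shows "tensor_space V W \<subseteq> supported (A \<times> B)"
  unfolding tensor_space_def
  by (rule cvec.span_minimal[OF _ subspace_supported])
    (use assms in \<open>fastforce simp: supported_def tensor_vec_def\<close>)

lemma cinner_eq_sum:
  assumes "finite S" "x \<in> supported S"
  shows "cinner x y = (\<Sum>i\<in>S. x i * cnj (y i))"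
  unfolding cinner_def
  by (rule sum.mono_neutral_left) (use assms in \<open>auto simp: supported_def\<close>)

lemma cinner_diff_left:
  assumes "finite S" "x \<in> supported S" "y \<in> supported S"
  shows "cinner (x - y) z = cinner x z - cinner y z"
  using assms cvec.subspace_diff[OF subspace_supported assms(2,3)]
  by (simp add: cinner_eq_sum[OF assms(1)] sum_subtractf[symmetric] algebra_simps)

lemma cinner_eq_0_iff:
  assumes "finite S" "x \<in> supported S"
  shows "cinner x x = 0 \<longleftrightarrow> x = 0"
proof -
  have "cinner x x = of_real (\<Sum>i\<in>S. (cmod (x i))\<^sup>2)"
    by (simp add: cinner_eq_sum[OF assms] complex_norm_square del: of_real_power)
  also have "\<dots> = 0 \<longleftrightarrow> (\<forall>i\<in>S. x i = 0)"
    using assms(1) by (simp only: of_real_eq_0_iff) (simp add: sum_nonneg_eq_0_iff)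
  also have "\<dots> \<longleftrightarrow> x = 0"
    using assms(2) by (auto simp: supported_def fun_eq_iff)
  finally show ?thesis .
qed

lemma subspace_orthogonal_right: "cvec.subspace {z. cinner x z = 0}"
  by (auto simp: cvec.subspace_def cinner_def cscale_def algebra_simps sum.distrib
      sum_distrib_left[symmetric] mult.left_commute)

lemma subspace_orthogonal_left:
  assumes "finite S"
  shows "cvec.subspace {x \<in> supported S. \<forall>v\<in>V. cinner x v = 0}"
proof (rule cvec.subspaceI)
  show "0 \<in> {x \<in> supported S. \<forall>v\<in>V. cinner x v = 0}"
    by (simp add: supported_def cinner_def)
next
  fix x y assume xy: "x \<in> {x \<in> supported S. \<forall>v\<in>V. cinner x v = 0}"
    "y \<in> {x \<in> supported S. \<forall>v\<in>V. cinner x v = 0}"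
  then have s: "x \<in> supported S" "y \<in> supported S" "x + y \<in> supported S"
    by (auto intro: cvec.subspace_add[OF subspace_supported])
  have "cinner (x + y) v = cinner x v + cinner y v" for v
    unfolding cinner_eq_sum[OF assms s(1)] cinner_eq_sum[OF assms s(2)] cinner_eq_sum[OF assms s(3)]
    by (simp add: sum.distrib algebra_simps)
  then show "x + y \<in> {x \<in> supported S. \<forall>v\<in>V. cinner x v = 0}"
    using xy s(3) by auto
next
  fix c x assume x: "x \<in> {x \<in> supported S. \<forall>v\<in>V. cinner x v = 0}"
  then have s: "x \<in> supported S" "cscale c x \<in> supported S"
    by (auto intro: cvec.subspace_scale[OF subspace_supported])
  have "cinner (cscale c x) v = c * cinner x v" for v
    unfolding cinner_eq_sum[OF assms s(1)] cinner_eq_sum[OF assms s(2)]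
    by (simp add: cscale_def sum_distrib_left mult.assoc)
  then show "cscale c x \<in> {x \<in> supported S. \<forall>v\<in>V. cinner x v = 0}"
    using x s(2) by auto
qed

text \<open>Lets the property of being decomposable into a part in \<open>W\<close> and a part in \<open>U\<close> be checked on pure
tensors.\<close>

lemma subspace_decomposable:
  assumes f: "clinear f" and W: "cvec.subspace W" and U: "cvec.subspace U"
  shows "cvec.subspace {x. \<exists>w\<in>W. f x - w \<in> U}"
proof (rule cvec.subspaceI)
  show "0 \<in> {x. \<exists>w\<in>W. f x - w \<in> U}"
    using clinear_zero[OF f] cvec.subspace_0[OF W] cvec.subspace_0[OF U] by force
next
  fix x y assume "x \<in> {x. \<exists>w\<in>W. f x - w \<in> U}" "y \<in> {x. \<exists>w\<in>W. f x - w \<in> U}"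
  then obtain v w where vw: "v \<in> W" "f x - v \<in> U" "w \<in> W" "f y - w \<in> U" by blast
  have "f (x + y) - (v + w) = (f x - v) + (f y - w)"
    unfolding clinear_add[OF f] by (simp add: algebra_simps)
  also have "\<dots> \<in> U" by (rule cvec.subspace_add[OF U vw(2,4)])
  finally show "x + y \<in> {x. \<exists>w\<in>W. f x - w \<in> U}"
    using cvec.subspace_add[OF W vw(1,3)] by blast
next
  fix c x assume "x \<in> {x. \<exists>w\<in>W. f x - w \<in> U}"
  then obtain w where w: "w \<in> W" "f x - w \<in> U" by blast
  have "f (cscale c x) - cscale c w = cscale c (f x - w)"
    unfolding clinear_scale[OF f] cvec.scale_right_diff_distrib ..
  also have "\<dots> \<in> U" by (rule cvec.subspace_scale[OF U w(2)])
  finally show "cscale c x \<in> {x. \<exists>w\<in>W. f x - w \<in> U}"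
    using cvec.subspace_scale[OF W w(1)] by blast
qed

text \<open>One Gram-Schmidt step for each spanning vector.\<close>

lemma orthogonal_projection_span_exists:
  assumes "finite B" "finite S" "B \<subseteq> supported S" "x \<in> supported S"
  shows "\<exists>y\<in>cspan B. \<forall>z\<in>cspan B. cinner (x - y) z = 0"
  using assms(1,3,4)
proof (induction B arbitrary: x)
  case empty
  then show ?case by (simp add: cinner_def)
next
  case (insert b B)
  have span_B: "cspan B \<subseteq> supported S"
    using insert.prems(1) by (intro cvec.span_minimal subspace_supported) auto
  have B: "B \<subseteq> supported S" and b: "b \<in> supported S"
    using insert.prems(1) by auto
  obtain p where p: "p \<in> cspan B" "\<And>z. z \<in> cspan B \<Longrightarrow> cinner (b - p) z = 0"
    using insert.IH[OF B b] by blast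
  obtain q where q: "q \<in> cspan B" "\<And>z. z \<in> cspan B \<Longrightarrow> cinner (x - q) z = 0"
    using insert.IH[OF B insert.prems(2)] by blast
  \<comment> \<open>The part of the new vector orthogonal to the old span; if it is 0, the coefficient
    below is 0 by the convention on division.\<close>
  define c where "c = b - p"
  define y where "y = q + cscale (cinner (x - q) c / cinner c c) c"
  have sup: "c \<in> supported S" "x - q \<in> supported S"
    using insert.prems(2) b p(1) q(1) span_B unfolding c_def
    by (auto intro!: cvec.subspace_diff[OF subspace_supported] simp del: minus_apply)
  have inner_y: "cinner (x - y) z = cinner (x - q) z - cinner (x - q) c / cinner c c * cinner c z" for z
  proof -
    have split: "x - y = (x - q) - cscale (cinner (x - q) c / cinner c c) c"
      unfolding y_def by simp
    have scale_sup: "cscale a c \<in> supported S" for a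
      using cvec.subspace_scale[OF subspace_supported sup(1)] .
    have scale: "cinner (cscale a c) z = a * cinner c z" for a
      using scale_sup sup(1)
      by (simp add: cinner_eq_sum[OF assms(2)] sum_distrib_left) (simp add: cscale_def mult.assoc)
    show ?thesis
      unfolding split cinner_diff_left[OF assms(2) sup(2) scale_sup] scale ..
  qed
  have in_span: "B \<subseteq> cspan (insert b B)" "b \<in> cspan (insert b B)"
    by (auto intro: cvec.span_base)
  have sub: "cspan B \<subseteq> cspan (insert b B)"
    by (intro cvec.span_mono) auto
  have "y \<in> cspan (insert b B)"
    unfolding y_def c_def using p(1) q(1) sub in_span(2)
    by (intro cvec.span_add cvec.span_scale cvec.span_diff) auto
  moreover have "cinner (x - y) z = 0" if "z \<in> cspan (insert b B)" for z
    using that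
  proof (rule cspan_induct[OF _ subspace_orthogonal_right])
    have B: "cinner (x - y) z = 0" if "z \<in> cspan B" for z
      using p(2)[OF that] q(2)[OF that] unfolding inner_y c_def by simp
    have c: "cinner (x - y) c = 0"
    proof (cases "cinner c c = 0")
      case True
      then have "c = 0" using cinner_eq_0_iff[OF assms(2) sup(1)] by simp
      then show ?thesis by (simp add: cinner_def)
    next
      case False
      then show ?thesis unfolding inner_y by simp
    qed
    fix z assume "z \<in> insert b B"
    then show "cinner (x - y) z = 0"
    proof
      assume "z = b"
      then have "z = c + p" unfolding c_def by simp
      moreover have "cinner (x - y) (c + p) = 0"
        using cvec.subspace_add[OF subspace_orthogonal_right[of "x - y"], of c p] c B[OF p(1)] by simp
      ultimately show ?thesis by simp
    qed (use B cvec.span_base in auto)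
  qed
  ultimately show ?case by blast
qed

lemma subspace_finite_spanning:
  assumes "finite S" "cvec.subspace V" "V \<subseteq> supported S"
  obtains B where "finite B" "V = cspan B"
proof -
  define e where "e = (\<lambda>s. (\<lambda>i. if i = s then 1 else 0) :: 'a cvec)"
  have "x \<in> cspan (e ` S)" if x: "x \<in> supported S" for x
  proof -
    have "(\<Sum>s\<in>T. cscale (x s) (e s)) i = (if i \<in> T then x i else 0)" if "finite T" for T i
      using that by (induction T) (auto simp: cscale_def e_def)
    then have "x = (\<Sum>s\<in>S. cscale (x s) (e s))"
      using x assms(1) by (auto simp: fun_eq_iff supported_def)
    also have "\<dots> \<in> cspan (e ` S)"
      by (intro cvec.span_sum cvec.span_scale cvec.span_base) auto
    finally show ?thesis .
  qed
  then have V: "V \<subseteq> cspan (e ` S)" using assms(3) by auto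
  obtain B where B: "B \<subseteq> V" "cvec.independent B" "V \<subseteq> cspan B"
    using cvec.maximal_independent_subset[of V] by blast
  have "finite B"
    using cvec.independent_span_bound[OF _ B(2), of "e ` S"] B(1) V assms(1) by auto
  moreover have "V = cspan B"
    using B cvec.span_minimal[OF B(1) assms(2)] by auto
  ultimately show ?thesis using that by blast
qed

lemma orth_proj_eqI:
  assumes S: "finite S" "V \<subseteq> supported S" and V: "cvec.subspace V" and x: "x \<in> supported S"
    and y: "y \<in> V" "\<And>z. z \<in> V \<Longrightarrow> cinner (x - y) z = 0"
  shows "orth_proj V x = y"
  unfolding orth_proj_def
proof (rule the_equality)
  show "y \<in> V \<and> (\<forall>z\<in>V. cinner (x - y) z = 0)" using y by blast
next
  fix y' assume y': "y' \<in> V \<and> (\<forall>z\<in>V. cinner (x - y') z = 0)"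
  then have d: "y' - y \<in> V" using y cvec.subspace_diff[OF V] by blast
  have sup: "x - y \<in> supported S" "x - y' \<in> supported S"
    using x y(1) y' S(2) by (auto intro!: cvec.subspace_diff[OF subspace_supported])
  have "cinner ((x - y) - (x - y')) (y' - y) = 0"
    unfolding cinner_diff_left[OF S(1) sup] using y(2)[OF d] y' d by simp
  then have "cinner (y' - y) (y' - y) = 0" by simp
  then show "y' = y"
    using cinner_eq_0_iff[OF S(1)] d S(2) by auto
qed

lemma orthogonal_projection_exists:
  assumes S: "finite S" "V \<subseteq> supported S" and V: "cvec.subspace V" and x: "x \<in> supported S"
  obtains y where "y \<in> V" "\<And>z. z \<in> V \<Longrightarrow> cinner (x - y) z = 0"
proof -
  obtain B where B: "finite B" "V = cspan B"
    by (rule subspace_finite_spanning[OF S(1) V S(2)])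
  have "B \<subseteq> supported S"
    using B(2) S(2) cvec.span_superset[of B] by auto
  then show ?thesis
    using orthogonal_projection_span_exists[OF B(1) S(1) _ x] B(2) that by auto
qed

lemma orth_proj_works:
  assumes "finite S" "V \<subseteq> supported S" "cvec.subspace V" "x \<in> supported S"
  shows "orth_proj V x \<in> V" "z \<in> V \<Longrightarrow> cinner (x - orth_proj V x) z = 0"
proof -
  obtain y where "y \<in> V" "\<And>z. z \<in> V \<Longrightarrow> cinner (x - y) z = 0"
    by (rule orthogonal_projection_exists[OF assms]) blast
  with orth_proj_eqI[OF assms this]
  show "orth_proj V x \<in> V" "z \<in> V \<Longrightarrow> cinner (x - orth_proj V x) z = 0" by auto
qed

section \<open>Concatenation of multi-indices\<close>

lemma sum_idx_add:
  "(\<Sum>w\<in>idx N (k + l). f w) = (\<Sum>i\<in>idx N k. \<Sum>j\<in>idx N l. f (i @ j))"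
proof -
  have "(\<Sum>(i, j)\<in>idx N k \<times> idx N l. f (i @ j)) = (\<Sum>w\<in>idx N (k + l). f w)"
    by (rule sum.reindex_bij_witness[where i = "\<lambda>w. (take k w, drop k w)" and j = "\<lambda>(i, j). i @ j"])
      (auto simp: idx_length idx_append idx_add_iff)
  then show ?thesis
    by (simp add: sum.cartesian_product)
qed

lemma sum_idx_1: "(\<Sum>w\<in>idx N 1. f w) = (\<Sum>a\<in>{1..N}. f [a])"
  by (rule sum.reindex_bij_witness[where i = "\<lambda>a. [a]" and j = hd])
    (auto simp: idx_def length_Suc_conv)

text \<open>The identification of \<open>H\<^sup>\<otimes>\<^sup>k \<otimes> H\<^sup>\<otimes>\<^sup>l\<close> with \<open>H\<^sup>\<otimes>\<^sup>k\<^sup>+\<^sup>l\<close>. It applies for all \<open>l\<close> at once: multi-indices of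
another length than \<open>k + l\<close> are sent outside the support.\<close>

definition flatten :: "nat \<Rightarrow> (mind \<times> mind) cvec \<Rightarrow> mind cvec" where
  "flatten k t = (\<lambda>w. t (take k w, drop k w))"

lemma clinear_flatten: "clinear (flatten k)"
  by (auto simp: clinear_def flatten_def cscale_def plus_fun_def)

lemma flatten_supported:
  "t \<in> supported (idx N k \<times> idx N l) \<Longrightarrow> flatten k t \<in> supported (idx N (k + l))"
  by (auto simp: supported_def flatten_def idx_add_iff)

lemma flatten_isometric:
  assumes "s \<in> supported (idx N k \<times> idx N l)"
  shows "cinner (flatten k s) (flatten k t) = cinner s t"
proof -
  have "cinner (flatten k s) (flatten k t) =
      (\<Sum>i\<in>idx N k. \<Sum>j\<in>idx N l. s (i, j) * cnj (t (i, j)))"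
    unfolding cinner_eq_sum[OF finite_idx flatten_supported[OF assms]] sum_idx_add
    by (intro sum.cong refl) (simp add: flatten_def idx_length)
  also have "\<dots> = cinner s t"
    by (subst cinner_eq_sum[OF _ assms]) (auto simp: finite_idx sum.cartesian_product)
  finally show ?thesis .
qed

lemma flatten_assoc:
  "flatten (k + l) (tensor_map (flatten k) id t) =
   flatten k (tensor_map id (flatten l) (tensor_assoc t))"
  by (auto simp: flatten_def tensor_map_def tensor_assoc_def fun_eq_iff take_drop add.commute
      min_def)

lemma mat_apply_mat_mult:
  "mat_apply N k (mat_mult N l T S) x = mat_apply N l T (mat_apply N k S x)"
proof
  fix w
  have "mat_apply N k (mat_mult N l T S) x w = (\<Sum>i\<in>idx N k. \<Sum>j\<in>idx N l. T (w, j) * S (j, i) * x i)"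
    by (simp add: mat_apply_def mat_mult_def sum_distrib_right)
  also have "\<dots> = (\<Sum>j\<in>idx N l. \<Sum>i\<in>idx N k. T (w, j) * S (j, i) * x i)"
    by (rule sum.swap)
  also have "\<dots> = mat_apply N l T (mat_apply N k S x) w"
    by (simp add: mat_apply_def sum_distrib_left mult.assoc)
  finally show "mat_apply N k (mat_mult N l T S) x w = mat_apply N l T (mat_apply N k S x) w" .
qed

lemma mat_apply_mat_adj:
  assumes x: "x \<in> supported (idx N k)" and Tx: "mat_apply N k T x \<in> supported (idx N l)"
  shows "cinner (mat_apply N k T x) y = cinner x (mat_apply N l (mat_adj T) y)"
proof -
  have "cinner (mat_apply N k T x) y = (\<Sum>j\<in>idx N l. \<Sum>i\<in>idx N k. T (j, i) * x i * cnj (y j))"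
    unfolding cinner_eq_sum[OF finite_idx Tx] by (simp add: mat_apply_def sum_distrib_right)
  also have "\<dots> = (\<Sum>i\<in>idx N k. \<Sum>j\<in>idx N l. T (j, i) * x i * cnj (y j))"
    by (rule sum.swap)
  also have "\<dots> = cinner x (mat_apply N l (mat_adj T) y)"
    unfolding cinner_eq_sum[OF finite_idx x]
    by (simp add: mat_apply_def mat_adj_def sum_distrib_left mult_ac)
  finally show ?thesis .
qed

lemma mat_apply_mat_tensor:
  "mat_apply N (k + l) (mat_tensor k k' T S) (flatten k t) =
   flatten k' (tensor_map (mat_apply N k T) (mat_apply N l S) t)"
proof
  fix w
  have "mat_apply N (k + l) (mat_tensor k k' T S) (flatten k t) w =
      (\<Sum>i\<in>idx N k. \<Sum>j\<in>idx N l. T (take k' w, i) * S (drop k' w, j) * t (i, j))"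
    unfolding mat_apply_def sum_idx_add mat_tensor_def flatten_def
    by (intro sum.cong refl) (simp add: idx_length)
  also have "\<dots> = (\<Sum>j\<in>idx N l. \<Sum>i\<in>idx N k. T (take k' w, i) * S (drop k' w, j) * t (i, j))"
    by (rule sum.swap)
  also have "\<dots> = flatten k' (tensor_map (mat_apply N k T) (mat_apply N l S) t) w"
    by (simp add: mat_apply_def tensor_map_def flatten_def sum_distrib_left mult_ac)
  finally show "mat_apply N (k + l) (mat_tensor k k' T S) (flatten k t) w =
      flatten k' (tensor_map (mat_apply N k T) (mat_apply N l S) t) w" .
qed

lemma mat_apply_mat_id:
  assumes "x \<in> supported (idx N k)"
  shows "mat_apply N k (mat_id N k) x = x"
proof
  fix w
  have "mat_apply N k (mat_id N k) x w = (\<Sum>i\<in>idx N k. if i = w then x i else 0)"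
    unfolding mat_apply_def mat_id_def by (intro sum.cong) auto
  then show "mat_apply N k (mat_id N k) x w = x w"
    using assms by (auto simp: finite_idx supported_def)
qed

section \<open>Categories and modules\<close>

lemma K_space_supported: "N > 0 \<Longrightarrow> K_space N P n \<subseteq> supported (idx N n)"
  unfolding K_space_def
  by (rule cvec.span_minimal[OF _ subspace_supported]) (auto simp: supported_def eta_eq)

lemma K_space_induct:
  assumes "x \<in> K_space N P n" "cvec.subspace {x. Q x}"
    and "\<And>p. p \<in> P \<inter> parts n n \<Longrightarrow> Q (eta N n p)"
  shows "Q x"
  using assms(1)[unfolded K_space_def] by (rule cspan_induct) (use assms in auto)

lemma subspace_K_space: "cvec.subspace (K_space N P n)"
  unfolding K_space_def by (rule cvec.subspace_span)

locale partition_module =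
  fixes C :: "nat \<Rightarrow> nat \<Rightarrow> part set" and P :: "part set" and N :: nat
  assumes category: "category_of_partitions C"
    and module_of: "module_of_projective_partitions C P"
    and N_pos: "N > 0"
begin

abbreviation K :: "nat \<Rightarrow> mind cvec set" where
  "K \<equiv> K_space N P"

text \<open>The intertwiner spaces of the easy quantum group, in the form in which its defining property gives
them.\<close>

abbreviation Hom :: "nat \<Rightarrow> nat \<Rightarrow> op set" where
  "Hom k l \<equiv> cspan (T_part N k l ` C k l)"

lemma category_parts: "r \<in> C k l \<Longrightarrow> r \<in> parts k l"
  and category_hcat: "p \<in> C k l \<Longrightarrow> q \<in> C m n \<Longrightarrow> hcat k l p q \<in> C (k + m) (l + n)"
  and category_vcat: "p \<in> C k l \<Longrightarrow> q \<in> C l m \<Longrightarrow> vcat q p \<in> C k m"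
  and category_pstar: "p \<in> C k l \<Longrightarrow> pstar p \<in> C l k"
  and category_pair: "pair_part \<in> C 0 2"
  and category_id: "id_part 1 \<in> C 1 1"
  using category unfolding category_of_partitions_def by blast+

lemma module_hcat: "p \<in> P \<inter> parts k k \<Longrightarrow> q \<in> P \<inter> parts l l \<Longrightarrow> hcat k k p q \<in> P \<inter> parts (k + l) (k + l)"
  and module_conjugate: "r \<in> C k l \<Longrightarrow> p \<in> P \<inter> parts k k \<Longrightarrow> vcat (vcat r p) (pstar r) \<in> P \<inter> parts l l"
  and module_pbar: "p \<in> P \<inter> parts k k \<Longrightarrow> pbar k p \<in> P \<inter> parts k k"
  using module_of unfolding module_of_projective_partitions_def by blast+

text \<open>A partition determines the lengths of its rows, so an element of \<open>P\<close> in \<open>P(k,k)\<close> is projective as an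
element of that very set.\<close>

lemma module_projective:
  assumes "p \<in> P \<inter> parts k k"
  shows "projective_partition k p"
proof -
  obtain k' where k': "projective_partition k' p"
    using assms module_of unfolding module_of_projective_partitions_def by blast
  have "Inl ` {..<k'} \<union> Inr ` {..<k'} = Inl ` {..<k} \<union> (Inr ` {..<k} :: (nat + nat) set)"
    using projective_covers[OF k'] covers_parts[of p k k] assms unfolding covers_def by auto
  then have "Inl -` (Inl ` {..<k'} \<union> Inr ` {..<k'}) = Inl -` (Inl ` {..<k} \<union> (Inr ` {..<k} :: (nat + nat) set))"
    by (rule arg_cong)
  moreover have "Inl -` (Inl ` {..<j} \<union> (Inr ` {..<j} :: (nat + nat) set)) = {..<j}" for j
    by auto
  ultimately have "{..<k'} = {..<k}" by simp
  then show ?thesis using k' by simp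
qed

lemma category_id_part: "id_part n \<in> C n n"
proof (induction n)
  case 0
  have "vcat (pstar pair_part) pair_part \<in> C 0 0"
    by (rule category_vcat[OF category_pair category_pstar[OF category_pair]])
  moreover have "p = {}" if "p \<in> C 0 0" for p
    using category_parts[OF that] by (simp add: parts_def partition_on_empty)
  ultimately have "{} \<in> C 0 0" by metis
  then show ?case by (simp add: id_part_def)
next
  case (Suc n)
  have "id_part (Suc n) = hcat n n (id_part n) (id_part 1)"
    unfolding hcat_def id_part_def setcompr_eq_image
    by (simp add: image_image lessThan_Suc lessThan_def[symmetric])
  then show ?case using category_hcat[OF Suc category_id] by simp
qed

lemma category_to_zero: "\<exists>r. r \<in> C (2 * k) 0"
proof (induction k)
  case 0
  then show ?case using category_id_part[of 0] by auto
next
  case (Suc k)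
  then obtain r where "r \<in> C (2 * k) 0" by blast
  then have "hcat (2 * k) 0 r (pstar pair_part) \<in> C (2 * k + 2) (0 + 0)"
    by (rule category_hcat) (intro category_pstar category_pair)
  then show ?case by auto
qed

text \<open>Doubling an element of \<open>P\<close> makes its rows even, and an even row is closed up by pairs from the
category.\<close>

lemma empty_part_mem: "{} \<in> P \<inter> parts 0 0"
proof -
  obtain p k where "p \<in> P" "projective_partition k p"
    using module_of unfolding module_of_projective_partitions_def by blast
  then have "p \<in> P \<inter> parts k k" by (simp add: projective_partition_def)
  then have pp: "hcat k k p p \<in> P \<inter> parts (2 * k) (2 * k)"
    using module_hcat[of p k p k] by (simp add: mult_2)
  obtain r where "r \<in> C (2 * k) 0" using category_to_zero by blast
  from module_conjugate[OF this pp] show ?thesis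
    by (auto simp: parts_def partition_on_empty)
qed

lemma K_0: "K 0 = range (\<lambda>c i. if i = [] then c else 0)"
proof -
  have "P \<inter> parts 0 0 = {{}}"
    using empty_part_mem by (auto simp: parts_def partition_on_empty)
  moreover have "eta N 0 {} = (\<lambda>i. if i = [] then 1 else 0)"
    by (auto simp: eta_eq[OF N_pos] idx_def delta_def fun_eq_iff)
  ultimately have "K 0 = cspan {\<lambda>i. if i = [] then 1 else 0}"
    unfolding K_space_def by simp
  also have "\<dots> = range (\<lambda>c. cscale c (\<lambda>i. if i = [] then 1 else 0))"
    by (rule cvec.span_singleton)
  also have "\<dots> = range (\<lambda>c i. if i = [] then c else 0)"
    by (intro image_cong refl) (auto simp: cscale_def)
  finally show ?thesis .
qed

lemma eta_mem: "p \<in> P \<inter> parts n n \<Longrightarrow> eta N n p \<in> K n"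
  unfolding K_space_def by (intro cvec.span_base imageI)

lemma K_supported: "x \<in> K n \<Longrightarrow> x \<in> supported (idx N n)"
  using K_space_supported[OF N_pos] by blast

lemma category_covers: "r \<in> C k l \<Longrightarrow> covers k l r"
  by (intro covers_parts category_parts)

lemma T_part_eta_module:
  assumes "r \<in> C k l" "p \<in> P \<inter> parts k k"
  shows "mat_apply N k (T_part N k l r) (eta N k p) =
    cscale (of_nat N ^ rl r p) (eta N l (vcat (vcat r p) (pstar r)))"
  using T_part_eta[OF category_covers[OF assms(1)] module_projective[OF assms(2)] N_pos] .

lemma morphism_preserves_K:
  assumes "T \<in> Hom k l" "x \<in> K k"
  shows "mat_apply N k T x \<in> K l"
  using assms(1)
proof (rule cspan_induct)
  show "cvec.subspace {T. mat_apply N k T x \<in> K l}"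
    by (rule subspace_vimage_clinear[OF clinear_mat_apply_op subspace_K_space])
  fix T assume "T \<in> T_part N k l ` C k l"
  then obtain r where r: "r \<in> C k l" "T = T_part N k l r" by blast
  show "mat_apply N k T x \<in> K l"
    using assms(2)
  proof (rule K_space_induct)
    show "cvec.subspace {x. mat_apply N k T x \<in> K l}"
      by (rule subspace_vimage_clinear[OF clinear_mat_apply subspace_K_space])
    fix p assume p: "p \<in> P \<inter> parts k k"
    show "mat_apply N k T (eta N k p) \<in> K l"
      unfolding r(2) T_part_eta_module[OF r(1) p]
      by (rule cvec.subspace_scale[OF subspace_K_space eta_mem[OF module_conjugate[OF r(1) p]]])
  qed
qed

lemma flatten_eta:
  assumes "p \<in> P \<inter> parts k k"
  shows "flatten k (tensor_vec (eta N k p) (eta N l q)) = eta N (k + l) (hcat k k p q)"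
  using eta_hcat[OF N_pos projective_covers[OF module_projective[OF assms]], of l q]
  by (auto simp: flatten_def tensor_vec_def)

lemma flatten_mem:
  assumes "t \<in> tensor_space (K k) (K l)"
  shows "flatten k t \<in> K (k + l)"
  using assms
proof (rule tensor_space_induct)
  show "cvec.subspace {t. flatten k t \<in> K (k + l)}"
    by (rule subspace_vimage_clinear[OF clinear_flatten subspace_K_space])
  fix x y assume x: "x \<in> K k" and y: "y \<in> K l"
  show "flatten k (tensor_vec x y) \<in> K (k + l)"
    using x
  proof (rule K_space_induct)
    show "cvec.subspace {x. flatten k (tensor_vec x y) \<in> K (k + l)}"
      by (rule subspace_vimage_clinear[OF clinear_compose[OF clinear_flatten clinear_tensor_vec_left]
            subspace_K_space])
    fix p assume p: "p \<in> P \<inter> parts k k"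
    show "flatten k (tensor_vec (eta N k p) y) \<in> K (k + l)"
      using y
    proof (rule K_space_induct)
      show "cvec.subspace {y. flatten k (tensor_vec (eta N k p) y) \<in> K (k + l)}"
        by (rule subspace_vimage_clinear[OF clinear_compose[OF clinear_flatten clinear_tensor_vec_right]
              subspace_K_space])
      fix q assume q: "q \<in> P \<inter> parts l l"
      show "flatten k (tensor_vec (eta N k p) (eta N l q)) \<in> K (k + l)"
        unfolding flatten_eta[OF p] by (intro eta_mem module_hcat p q)
    qed
  qed
qed

lemma tensor_K_supported: "t \<in> tensor_space (K k) (K l) \<Longrightarrow> t \<in> supported (idx N k \<times> idx N l)"
  using tensor_space_supported[OF K_space_supported[OF N_pos] K_space_supported[OF N_pos]] by blast

section \<open>Contraction of slices\<close>

text \<open>Contracting two neighbouring tensor legs is the operator of a partition in the category: a cap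
between identity strands.\<close>

lemma contract_adjacent_mem:
  assumes z: "z \<in> K (n + (2 + t))"
  shows "(\<lambda>w. \<Sum>a\<in>{1..N}. z (take n w @ [a, a] @ drop n w)) \<in> K (n + t)"
proof -
  define r where "r = hcat n n (id_part n) (hcat 2 0 (pstar pair_part) (id_part t))"
  have r: "r \<in> C (n + (2 + t)) (n + (0 + t))"
    unfolding r_def by (intro category_hcat category_id_part category_pstar category_pair)
  let ?T = "T_part N (n + (2 + t)) (n + (0 + t)) r"
  have "mat_apply N (n + (2 + t)) ?T z w = (\<Sum>a\<in>{1..N}. z (take n w @ [a, a] @ drop n w))" for w
  proof (cases "w \<in> idx N (n + t)")
    case True
    then have w: "take n w \<in> idx N n" "drop n w \<in> idx N t" and lw: "length w = n + t"
      by (auto simp: idx_add_iff idx_length)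
    have delta: "delta r (x @ [a, b] @ y) w \<longleftrightarrow> x = take n w \<and> a = b \<and> y = drop n w"
      if "length x = n" "length y = t" for x y a b
      unfolding r_def using that lw
      by (simp add: delta_hcat[OF covers_id_part] delta_hcat[OF covers_pstar[OF covers_pair_part]]
          delta_id_part delta_pstar delta_pair_part)
    have "mat_apply N (n + (2 + t)) ?T z w =
        (\<Sum>i\<in>idx N (n + (2 + t)). if delta r i w then z i else 0)"
      unfolding mat_apply_def T_part_def using True by (intro sum.cong) auto
    also have "\<dots> = (\<Sum>a\<in>{1..N}. z (take n w @ [a, a] @ drop n w))"
    proof (subst sum.inter_filter[symmetric, OF finite_idx],
        rule sum.reindex_bij_witness[where i = "\<lambda>a. take n w @ [a, a] @ drop n w" and j = "\<lambda>i. i ! n"])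
      fix i assume i: "i \<in> {i \<in> idx N (n + (2 + t)). delta r i w}"
      then have li: "length i = n + (2 + t)" by (auto simp: idx_length)
      have split: "take n i @ [i ! n, i ! Suc n] @ drop (Suc (Suc n)) i = i"
        using li by (simp add: Cons_nth_drop_Suc)
      have len: "length (take n i) = n" "length (drop (Suc (Suc n)) i) = t" using li by auto
      have "delta r (take n i @ [i ! n, i ! Suc n] @ drop (Suc (Suc n)) i) w"
        unfolding split using i by simp
      then have parts: "take n i = take n w" "i ! n = i ! Suc n" "drop (Suc (Suc n)) i = drop n w"
        unfolding delta[OF len] by blast+
      then have "take n w @ [i ! n, i ! n] @ drop n w =
          take n i @ [i ! n, i ! Suc n] @ drop (Suc (Suc n)) i"
        by simp
      then show eq: "take n w @ [i ! n, i ! n] @ drop n w = i" unfolding split .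
      show "i ! n \<in> {1..N}" using i li idx_nth[of i N "n + (2 + t)" n] by auto
      show "z (take n w @ [i ! n, i ! n] @ drop n w) = z i" unfolding eq ..
    next
      fix a assume a: "a \<in> {1..N}"
      have lt: "length (take n w) = n" "length (drop n w) = t" using lw by auto
      show "(take n w @ [a, a] @ drop n w) ! n = a" using lw by (simp add: nth_append)
      have "[a, a] @ drop n w \<in> idx N (2 + t)"
        using a w(2) by (auto simp: idx_def)
      then show "take n w @ [a, a] @ drop n w \<in> {i \<in> idx N (n + (2 + t)). delta r i w}"
        using w(1) delta[OF lt] idx_append[OF lt(1), of "[a, a] @ drop n w" N "2 + t"] by auto
    qed
    finally show ?thesis .
  next
    case False
    have "z (take n w @ [a, a] @ drop n w) = 0" for a
    proof -
      have "take n w @ [a, a] @ drop n w \<notin> idx N (n + (2 + t))"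
        using False set_append[of "take n w" "drop n w"] by (auto simp: idx_def)
      then show ?thesis using K_supported[OF z] by (simp add: supported_def)
    qed
    moreover have "mat_apply N (n + (2 + t)) ?T z w = 0"
      using False by (simp add: mat_apply_def T_part_def)
    ultimately show ?thesis by simp
  qed
  then have "(\<lambda>w. \<Sum>a\<in>{1..N}. z (take n w @ [a, a] @ drop n w)) = mat_apply N (n + (2 + t)) ?T z"
    by (intro ext) simp
  also have "\<dots> \<in> K (n + (0 + t))"
    by (rule morphism_preserves_K[OF _ z]) (intro cvec.span_base imageI r)
  finally show ?thesis by simp
qed

text \<open>The reflected nested pairing, applied as a succession of contractions of neighbouring legs,
innermost pair first.\<close>

lemma contract_nested_mem:
  assumes "z \<in> K (l + (m + m))"
  shows "(\<lambda>w. \<Sum>j\<in>idx N m. z (w @ j @ rev j)) \<in> K l"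
  using assms
proof (induction m arbitrary: z)
  case 0
  have "idx N 0 = {[]}" by (auto simp: idx_def)
  with 0 show ?case by simp
next
  case (Suc m)
  let ?y = "\<lambda>w. \<Sum>a\<in>{1..N}. z (take (l + m) w @ [a, a] @ drop (l + m) w)"
  \<comment> \<open>The innermost pair has \<open>l + m\<close> legs on its left and \<open>m\<close> legs on its right.\<close>
  have eq: "l + (Suc m + Suc m) = (l + m) + (2 + m)" by simp
  have "?y \<in> K (l + (m + m))"
    using contract_adjacent_mem[OF Suc.prems[unfolded eq]] by (simp only: add.assoc)
  from Suc.IH[OF this] have mem: "(\<lambda>w. \<Sum>j\<in>idx N m. ?y (w @ j @ rev j)) \<in> K l" .
  moreover have "(\<Sum>j\<in>idx N (Suc m). z (w @ j @ rev j)) = (\<Sum>j\<in>idx N m. ?y (w @ j @ rev j))" for w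
  proof (cases "length w = l")
    case True
    have "(\<Sum>j\<in>idx N (Suc m). z (w @ j @ rev j)) =
        (\<Sum>j\<in>idx N m. \<Sum>a\<in>{1..N}. z (w @ (j @ [a]) @ rev (j @ [a])))"
      using sum_idx_add[where N = N and k = m and l = 1 and f = "\<lambda>j. z (w @ j @ rev j)"]
      unfolding sum_idx_1 by simp
    also have "\<dots> = (\<Sum>j\<in>idx N m. ?y (w @ j @ rev j))"
      using True by (intro sum.cong refl) (simp add: idx_length)
    finally show ?thesis .
  next
    case False
    have "w @ j @ rev j \<notin> idx N (l + (Suc m + Suc m))" if "j \<in> idx N (Suc m)" for j
      using that False by (auto simp: idx_def)
    then have "(\<Sum>j\<in>idx N (Suc m). z (w @ j @ rev j)) = 0"
      using K_supported[OF Suc.prems] by (intro sum.neutral) (simp add: supported_def)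
    moreover have "w \<notin> idx N l" using False by (auto simp: idx_def)
    then have "(\<Sum>j\<in>idx N m. ?y (w @ j @ rev j)) = 0"
      using K_supported[OF mem] by (simp add: supported_def)
    ultimately show ?thesis by simp
  qed
  ultimately show ?case by simp
qed

text \<open>The sum is \<open>(id \<otimes> D\<^sub>m\<^sup>*) (z \<otimes> \<eta>)\<close> for \<open>\<eta>\<close> belonging to the rotation of \<open>s\<close>, which reads the entries of
\<open>\<eta>\<^sub>s\<close> backwards.\<close>

lemma slice_mem:
  assumes z: "z \<in> K (l + m)" and s: "s \<in> P \<inter> parts m m"
  shows "(\<lambda>w. \<Sum>j\<in>idx N m. z (w @ j) * eta N m s j) \<in> K l"
proof -
  let ?Z = "flatten (l + m) (tensor_vec z (eta N m (pbar m s)))"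
  have "?Z \<in> K ((l + m) + m)"
    by (intro flatten_mem tensor_vec_mem z eta_mem module_pbar s)
  then have "?Z \<in> K (l + (m + m))" by (simp only: add.assoc)
  then have "(\<lambda>w. \<Sum>j\<in>idx N m. ?Z (w @ j @ rev j)) \<in> K l" by (rule contract_nested_mem)
  moreover have "(\<Sum>j\<in>idx N m. ?Z (w @ j @ rev j)) = (\<Sum>j\<in>idx N m. z (w @ j) * eta N m s j)" for w
  proof (rule sum.cong[OF refl])
    fix j assume j: "j \<in> idx N m"
    show "?Z (w @ j @ rev j) = z (w @ j) * eta N m s j"
    proof (cases "length w = l")
      case True
      then show ?thesis
        using idx_length[OF j]
        by (simp add: flatten_def tensor_vec_def eta_pbar[OF N_pos module_projective[OF s]])
    next
      case False
      have "w @ j \<notin> idx N (l + m)" "w @ j @ rev j \<notin> idx N ((l + m) + m)"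
        using False idx_length[OF j] by (auto simp: idx_def)
      then show ?thesis
        using K_supported[OF z] K_supported[OF \<open>?Z \<in> K ((l + m) + m)\<close>] by (simp add: supported_def)
    qed
  qed
  ultimately show ?thesis by simp
qed

section \<open>The ranges of the embeddings\<close>

abbreviation range_pair :: "nat \<Rightarrow> nat \<Rightarrow> mind cvec set" where
  "range_pair k l \<equiv> flatten k ` tensor_space (K k) (K l)"

abbreviation range_triple :: "nat \<Rightarrow> nat \<Rightarrow> nat \<Rightarrow> mind cvec set" where
  "range_triple k l m \<equiv> (\<lambda>t. flatten (k + l) (tensor_map (flatten k) id t)) `
     tensor_space (tensor_space (K k) (K l)) (K m)"

lemma clinear_flatten_triple: "clinear (\<lambda>t. flatten (k + l) (tensor_map (flatten k) id t))"
  by (intro clinear_compose[OF clinear_flatten] clinear_tensor_map clinear_flatten clinear_id)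

lemma subspace_range_pair: "cvec.subspace (range_pair k l)"
  by (intro subspace_image_clinear clinear_flatten subspace_tensor_space)

lemma subspace_range_triple: "cvec.subspace (range_triple k l m)"
  by (intro subspace_image_clinear clinear_flatten_triple subspace_tensor_space)

lemma range_pair_subset: "range_pair k l \<subseteq> K (k + l)"
  using flatten_mem by blast

lemma range_triple_subset_left: "range_triple k l m \<subseteq> range_pair (k + l) m"
proof -
  have "tensor_map (flatten k) id t \<in> tensor_space (K (k + l)) (K m)"
    if "t \<in> tensor_space (tensor_space (K k) (K l)) (K m)" for t
    using that
  proof (rule tensor_space_induct)
    show "cvec.subspace {t. tensor_map (flatten k) id t \<in> tensor_space (K (k + l)) (K m)}"
      by (intro subspace_vimage_clinear clinear_tensor_map clinear_flatten clinear_id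
          subspace_tensor_space)
    fix x y assume "x \<in> tensor_space (K k) (K l)" "y \<in> K m"
    then show "tensor_map (flatten k) id (tensor_vec x y) \<in> tensor_space (K (k + l)) (K m)"
      unfolding tensor_map_tensor_vec[OF clinear_flatten clinear_id]
      by (auto intro: tensor_vec_mem flatten_mem)
  qed
  then show ?thesis by blast
qed

lemma flatten_tensor_flatten:
  "flatten k (tensor_vec x (flatten l (tensor_vec y z))) =
   flatten (k + l) (tensor_map (flatten k) id (tensor_vec (tensor_vec x y) z))"
  by (simp add: flatten_def tensor_vec_def tensor_map_def fun_eq_iff take_drop add.commute min_def
      mult.assoc)

lemma flatten_range_pair_mem:
  assumes x: "x \<in> K k" and y: "y \<in> range_pair l m"
  shows "flatten k (tensor_vec x y) \<in> range_triple k l m"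
proof -
  obtain t where t: "t \<in> tensor_space (K l) (K m)" "y = flatten l t" using y by blast
  have "flatten k (tensor_vec x (flatten l t)) \<in> range_triple k l m"
    using t(1)
  proof (rule tensor_space_induct)
    show "cvec.subspace {t. flatten k (tensor_vec x (flatten l t)) \<in> range_triple k l m}"
      by (intro subspace_vimage_clinear clinear_compose[OF clinear_flatten]
          clinear_compose[OF clinear_tensor_vec_right] clinear_flatten subspace_range_triple)
    fix u v assume "u \<in> K l" "v \<in> K m"
    then show "flatten k (tensor_vec x (flatten l (tensor_vec u v))) \<in> range_triple k l m"
      unfolding flatten_tensor_flatten using x by (intro imageI tensor_vec_mem)
  qed
  then show ?thesis using t(2) by simp
qed

lemma range_triple_subset_right: "range_triple k l m \<subseteq> range_pair k (l + m)"
proof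
  fix w assume "w \<in> range_triple k l m"
  then obtain t where t: "t \<in> tensor_space (tensor_space (K k) (K l)) (K m)"
    and w: "w = flatten (k + l) (tensor_map (flatten k) id t)" by blast
  from t have "flatten (k + l) (tensor_map (flatten k) id t) \<in> range_pair k (l + m)"
  proof (rule tensor_space_induct)
    show "cvec.subspace {t. flatten (k + l) (tensor_map (flatten k) id t) \<in> range_pair k (l + m)}"
      by (intro subspace_vimage_clinear clinear_flatten_triple subspace_range_pair)
    fix s z assume s: "s \<in> tensor_space (K k) (K l)" and z: "z \<in> K m"
    from s show "flatten (k + l) (tensor_map (flatten k) id (tensor_vec s z)) \<in> range_pair k (l + m)"
    proof (rule tensor_space_induct)
      show "cvec.subspace {s. flatten (k + l) (tensor_map (flatten k) id (tensor_vec s z))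
          \<in> range_pair k (l + m)}"
        by (intro subspace_vimage_clinear clinear_compose[OF clinear_flatten_triple]
            clinear_tensor_vec_left subspace_range_pair)
      fix x y assume "x \<in> K k" "y \<in> K l"
      with z show "flatten (k + l) (tensor_map (flatten k) id (tensor_vec (tensor_vec x y) z))
          \<in> range_pair k (l + m)"
        unfolding flatten_tensor_flatten[symmetric] by (intro imageI tensor_vec_mem flatten_mem)
    qed
  qed
  with w show "w \<in> range_pair k (l + m)" by simp
qed

text \<open>The slice \<open>g\<close> belongs to \<open>K l\<close>, so \<open>g \<otimes> \<eta>\<^sub>s\<close> belongs to \<open>K\<^sub>l \<otimes> K\<^sub>m\<close>, and pairing \<open>z\<close> with it gives
the squared norm of \<open>g\<close>.\<close>

lemma slice_of_orthogonal_eq_0: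
  assumes z: "z \<in> K (l + m)" and orth: "\<And>v. v \<in> range_pair l m \<Longrightarrow> cinner z v = 0"
    and s: "s \<in> P \<inter> parts m m"
  shows "(\<Sum>j\<in>idx N m. z (w @ j) * eta N m s j) = 0"
proof -
  let ?g = "\<lambda>w. \<Sum>j\<in>idx N m. z (w @ j) * eta N m s j"
  have g: "?g \<in> K l" by (rule slice_mem[OF z s])
  have "cinner ?g ?g = cinner z (flatten l (tensor_vec ?g (eta N m s)))"
  proof -
    have "cinner z (flatten l (tensor_vec ?g (eta N m s))) =
        (\<Sum>i\<in>idx N l. \<Sum>j\<in>idx N m. z (i @ j) * eta N m s j * cnj (?g i))"
      unfolding cinner_eq_sum[OF finite_idx K_supported[OF z]] sum_idx_add
      by (intro sum.cong refl)
        (simp add: flatten_def tensor_vec_def idx_length eta_eq[OF N_pos])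
    also have "\<dots> = cinner ?g ?g"
      unfolding cinner_eq_sum[OF finite_idx K_supported[OF g]] sum_distrib_right ..
    finally show ?thesis by simp
  qed
  also have "\<dots> = 0"
    by (intro orth imageI tensor_vec_mem g eta_mem s)
  finally have "?g = 0"
    using cinner_eq_0_iff[OF finite_idx K_supported[OF g]] by simp
  then show ?thesis by (simp add: fun_eq_iff)
qed

text \<open>Pairing \<open>x \<otimes> z\<close> with \<open>a \<otimes> \<eta>\<^sub>s\<close> involves \<open>z\<close> only through its slice by \<open>\<eta>\<^sub>s\<close>.\<close>

lemma flatten_orthogonal:
  assumes x: "x \<in> K k" and z: "z \<in> K (l + m)"
    and orth: "\<And>v. v \<in> range_pair l m \<Longrightarrow> cinner z v = 0"
    and v: "v \<in> range_pair (k + l) m"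
  shows "cinner (flatten k (tensor_vec x z)) v = 0"
proof -
  let ?u = "flatten k (tensor_vec x z)"
  have "?u \<in> K (k + (l + m))" by (intro flatten_mem tensor_vec_mem x z)
  then have u: "?u \<in> supported (idx N ((k + l) + m))"
    using K_supported by (simp only: add.assoc)
  obtain t where t: "t \<in> tensor_space (K (k + l)) (K m)" and vt: "v = flatten (k + l) t"
    using v by blast
  from t have "flatten (k + l) t \<in> {v. cinner ?u v = 0}"
  proof (rule tensor_space_induct)
    show "cvec.subspace {t. flatten (k + l) t \<in> {v. cinner ?u v = 0}}"
      by (rule subspace_vimage_clinear[OF clinear_flatten subspace_orthogonal_right])
    fix a b assume b: "b \<in> K m"
    from b show "flatten (k + l) (tensor_vec a b) \<in> {v. cinner ?u v = 0}"
    proof (rule K_space_induct)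
      show "cvec.subspace {b. flatten (k + l) (tensor_vec a b) \<in> {v. cinner ?u v = 0}}"
        by (rule subspace_vimage_clinear[OF clinear_compose[OF clinear_flatten clinear_tensor_vec_right]
              subspace_orthogonal_right])
      fix s assume s: "s \<in> P \<inter> parts m m"
      have "cinner ?u (flatten (k + l) (tensor_vec a (eta N m s))) =
          (\<Sum>i\<in>idx N (k + l). \<Sum>j\<in>idx N m.
             x (take k i) * cnj (a i) * (z (drop k i @ j) * eta N m s j))"
        unfolding cinner_eq_sum[OF finite_idx u] sum_idx_add[where k = "k + l"]
        by (intro sum.cong refl)
          (simp add: flatten_def tensor_vec_def idx_length eta_eq[OF N_pos])
      also have "\<dots> = 0"
        by (simp add: sum_distrib_left[symmetric] slice_of_orthogonal_eq_0[OF z orth s])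
      finally show "flatten (k + l) (tensor_vec a (eta N m s)) \<in> {v. cinner ?u v = 0}" by simp
    qed
  qed
  with vt show ?thesis by simp
qed

text \<open>For \<open>u = x \<otimes> z\<close> the vector \<open>w\<close> is \<open>x \<otimes> y\<close> with \<open>y\<close> the projection of \<open>z\<close> onto \<open>K\<^sub>l \<otimes> K\<^sub>m\<close>.\<close>

lemma decompose_range_right:
  assumes "u \<in> range_pair k (l + m)"
  shows "\<exists>w\<in>range_triple k l m. \<forall>v\<in>range_pair (k + l) m. cinner (u - w) v = 0"
proof -
  let ?U = "{y \<in> supported (idx N (k + l + m)). \<forall>v\<in>range_pair (k + l) m. cinner y v = 0}"
  obtain t where t: "t \<in> tensor_space (K k) (K (l + m))" and ut: "u = flatten k t"
    using assms by blast
  from t have "\<exists>w\<in>range_triple k l m. flatten k t - w \<in> ?U"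
  proof (rule tensor_space_induct)
    show "cvec.subspace {t. \<exists>w\<in>range_triple k l m. flatten k t - w \<in> ?U}"
      by (intro subspace_decomposable clinear_flatten subspace_range_triple
          subspace_orthogonal_left finite_idx)
    fix x z assume x: "x \<in> K k" and z: "z \<in> K (l + m)"
    obtain y where y: "y \<in> range_pair l m" "\<And>v. v \<in> range_pair l m \<Longrightarrow> cinner (z - y) v = 0"
      using orthogonal_projection_exists[OF finite_idx order_trans[OF range_pair_subset
            K_space_supported[OF N_pos]] subspace_range_pair K_supported[OF z]] by blast
    have d: "z - y \<in> K (l + m)"
      using cvec.subspace_diff[OF subspace_K_space z] range_pair_subset y(1) by blast
    have "flatten k (tensor_vec x z) - flatten k (tensor_vec x y) = flatten k (tensor_vec x (z - y))"
      using clinear_diff[OF clinear_compose[OF clinear_flatten clinear_tensor_vec_right]] by metis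
    moreover have "flatten k (tensor_vec x (z - y)) \<in> K (k + l + m)"
      using flatten_mem[OF tensor_vec_mem[OF x d]] by (simp only: add.assoc)
    ultimately have "flatten k (tensor_vec x z) - flatten k (tensor_vec x y) \<in> ?U"
      using K_supported flatten_orthogonal[OF x d y(2)] by simp
    then show "\<exists>w\<in>range_triple k l m. flatten k (tensor_vec x z) - w \<in> ?U"
      using flatten_range_pair_mem[OF x y(1)] by blast
  qed
  with ut show ?thesis by blast
qed

text \<open>With \<open>u\<close> the inner projection of \<open>x\<close> and \<open>w\<close> its part in the triple range, \<open>w\<close> is the outer
projection of \<open>u\<close>. Moreover \<open>x - w\<close> is the sum of \<open>x - u\<close> and \<open>u - w\<close>, each orthogonal to a range that
contains the triple one.\<close>

lemma projections_compose:
  assumes x: "x \<in> K (k + l + m)"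
  shows "orth_proj (range_pair (k + l) m) (orth_proj (range_pair k (l + m)) x) =
    orth_proj (range_triple k l m) x"
proof -
  let ?S = "supported (idx N (k + l + m))"
  have S: "range_pair (k + l) m \<subseteq> ?S" "range_pair k (l + m) \<subseteq> ?S"
    using order_trans[OF range_pair_subset[of "k + l" m] K_space_supported[OF N_pos]]
      order_trans[OF range_pair_subset[of k "l + m"] K_space_supported[OF N_pos]]
    by (simp_all only: add.assoc)
  note xS = K_supported[OF x]
  define u where "u = orth_proj (range_pair k (l + m)) x"
  have u: "u \<in> range_pair k (l + m)" "\<And>v. v \<in> range_pair k (l + m) \<Longrightarrow> cinner (x - u) v = 0"
    unfolding u_def using orth_proj_works[OF finite_idx S(2) subspace_range_pair xS] by blast+
  then have uS: "u \<in> ?S" using S(2) by blast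
  obtain w where w: "w \<in> range_triple k l m" "\<And>v. v \<in> range_pair (k + l) m \<Longrightarrow> cinner (u - w) v = 0"
    using decompose_range_right[OF u(1)] by blast
  have wl: "w \<in> range_pair (k + l) m" using w(1) range_triple_subset_left by blast
  then have wS: "w \<in> ?S" using S(1) by blast
  have "orth_proj (range_pair (k + l) m) u = w"
    by (rule orth_proj_eqI[OF finite_idx S(1) subspace_range_pair uS wl w(2)])
  moreover have "orth_proj (range_triple k l m) x = w"
  proof (rule orth_proj_eqI[OF finite_idx order_trans[OF range_triple_subset_left S(1)]
        subspace_range_triple xS w(1)])
    fix v assume v: "v \<in> range_triple k l m"
    have "x - w = (x - u) - (w - u)" by simp
    moreover have "x - u \<in> ?S" "w - u \<in> ?S"
      by (intro cvec.subspace_diff[OF subspace_supported] xS uS wS)+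
    moreover have "cinner (x - u) v = 0" using u(2) v range_triple_subset_right by blast
    moreover have "cinner (w - u) v = 0"
      using w(2)[of v] v range_triple_subset_left cinner_diff_left[OF finite_idx wS uS, of v]
        cinner_diff_left[OF finite_idx uS wS, of v] by fastforce
    ultimately show "cinner (x - w) v = 0"
      by (simp only: cinner_diff_left[OF finite_idx] diff_self)
  qed
  ultimately show ?thesis unfolding u_def by simp
qed

end

section \<open>The tensor system of a module\<close>

theorem theorem4p6:
  fixes C :: "nat \<Rightarrow> nat \<Rightarrow> part set" and P :: "part set" and N :: nat
    and G :: "('a, 'm) qgroup_scheme"
    and K :: "nat \<Rightarrow> mind cvec set"
  defines "K \<equiv> K_space N P"
  assumes "category_of_partitions C"
    and "module_of_projective_partitions C P"
    and "N > 0"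
    and "easy_quantum_group N C G"
  shows "\<exists>(\<phi> :: nat \<Rightarrow> nat \<Rightarrow> op \<Rightarrow> mind cvec \<Rightarrow> mind cvec)
          (\<iota> :: nat \<Rightarrow> nat \<Rightarrow> (mind \<times> mind) cvec \<Rightarrow> mind cvec).
    \<comment> \<open>\<open>\<phi>\<close> and \<open>\<iota>\<close> are well-defined linear maps with the prescribed values\<close>
    (\<forall>k l. \<forall>T\<in>Mor N G k l. linear_map_on (K k) (K l) (\<phi> k l T)) \<and>
    (\<forall>k l. \<forall>x\<in>K k. linear_map_on (Mor N G k l) (K l) (\<lambda>T. \<phi> k l T x)) \<and>
    (\<forall>k l. \<forall>r\<in>C k l. \<forall>p\<in>P \<inter> parts k k.
       \<phi> k l (T_part N k l r) (eta N k p) =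
         cscale (of_nat N ^ rl r p) (eta N l (vcat (vcat r p) (pstar r)))) \<and>
    (\<forall>k l. linear_map_on (tensor_space (K k) (K l)) (K (k + l)) (\<iota> k l)) \<and>
    (\<forall>k l. \<forall>p\<in>P \<inter> parts k k. \<forall>q\<in>P \<inter> parts l l.
       \<iota> k l (tensor_vec (eta N k p) (eta N l q)) = eta N (k + l) (hcat k k p q)) \<and>
    \<comment> \<open>\<open>K\<^sub>0 = \<complex>\<close>\<close>
    K 0 = range (\<lambda>c i. if i = [] then c else 0) \<and>
    \<comment> \<open>(F1)\<close>
    (\<forall>k. \<forall>x\<in>K k. \<phi> k k (mat_id N k) x = x) \<and>
    (\<forall>k l. \<forall>T\<in>Mor N G k l. adjoint_on (K k) (K l) (\<phi> k l T) (\<phi> l k (mat_adj T))) \<and>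
    (\<forall>k l m. \<forall>S\<in>Mor N G k l. \<forall>T\<in>Mor N G l m. \<forall>x\<in>K k.
       \<phi> k m (mat_mult N l T S) x = \<phi> l m T (\<phi> k l S x)) \<and>
    \<comment> \<open>(F2)\<close>
    (\<forall>k l. isometric_on (tensor_space (K k) (K l)) (\<iota> k l)) \<and>
    (\<forall>k l m. \<forall>t\<in>tensor_space (tensor_space (K k) (K l)) (K m).
       \<iota> (k + l) m (tensor_map (\<iota> k l) id t) =
       \<iota> k (l + m) (tensor_map id (\<iota> l m) (tensor_assoc t))) \<and>
    (\<forall>k k' l l'. \<forall>T\<in>Mor N G k k'. \<forall>S\<in>Mor N G l l'. \<forall>t\<in>tensor_space (K k) (K l).
       \<phi> (k + l) (k' + l') (mat_tensor k k' T S) (\<iota> k l t) =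
       \<iota> k' l' (tensor_map (\<phi> k k' T) (\<phi> l l' S) t)) \<and>
    \<comment> \<open>(F3)\<close>
    (\<forall>k l m.
       let P1 = orth_proj (\<iota> (k + l) m ` tensor_space (K (k + l)) (K m));
           P2 = orth_proj (\<iota> k (l + m) ` tensor_space (K k) (K (l + m)));
           P3 = orth_proj ((\<lambda>t. \<iota> (k + l) m (tensor_map (\<iota> k l) id t)) `
                           tensor_space (tensor_space (K k) (K l)) (K m))
       in op_le_on (K (k + l + m)) (P1 \<circ> P2) P3)"
proof -
  interpret partition_module C P N
    by unfold_locales (use assms in auto)
  have Mor: "Mor N G k l = cspan (T_part N k l ` C k l)" for k l
    using assms(5) by (simp add: easy_quantum_group_def)
  let ?\<phi> = "\<lambda>(k::nat) (l::nat) T. mat_apply N k T"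
  let ?\<iota> = "\<lambda>(k::nat) (l::nat). flatten k"
  show ?thesis
    unfolding K_def Mor
  proof (intro exI[of _ ?\<phi>] exI[of _ ?\<iota>] conjI allI ballI)
    fix k l T assume T: "T \<in> cspan (T_part N k l ` C k l)"
    show "linear_map_on (K_space N P k) (K_space N P l) (mat_apply N k T)"
      by (rule linear_map_on_clinear[OF clinear_mat_apply morphism_preserves_K[OF T]])
    show "adjoint_on (K_space N P k) (K_space N P l) (mat_apply N k T) (mat_apply N l (mat_adj T))"
      unfolding adjoint_on_def
      by (intro ballI mat_apply_mat_adj K_supported morphism_preserves_K[OF T])
  next
    fix k l x assume x: "x \<in> K_space N P k"
    show "linear_map_on (cspan (T_part N k l ` C k l)) (K_space N P l) (\<lambda>T. mat_apply N k T x)"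
      by (rule linear_map_on_clinear[OF clinear_mat_apply_op morphism_preserves_K[OF _ x]])
  next
    fix k l r p assume "r \<in> C k l" "p \<in> P \<inter> parts k k"
    then show "mat_apply N k (T_part N k l r) (eta N k p) =
        cscale (of_nat N ^ rl r p) (eta N l (vcat (vcat r p) (pstar r)))"
      by (rule T_part_eta_module)
  next
    fix k l
    show "linear_map_on (tensor_space (K_space N P k) (K_space N P l)) (K_space N P (k + l)) (flatten k)"
      by (rule linear_map_on_clinear[OF clinear_flatten flatten_mem])
    show "isometric_on (tensor_space (K_space N P k) (K_space N P l)) (flatten k)"
      unfolding isometric_on_def by (intro ballI flatten_isometric[OF tensor_K_supported])
  next
    fix k l p q assume "p \<in> P \<inter> parts k k"
    then show "flatten k (tensor_vec (eta N k p) (eta N l q)) = eta N (k + l) (hcat k k p q)"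
      by (rule flatten_eta)
  next
    show "K_space N P 0 = range (\<lambda>c i. if i = [] then c else 0)" by (rule K_0)
  next
    fix k x assume "x \<in> K_space N P k"
    then show "mat_apply N k (mat_id N k) x = x" by (intro mat_apply_mat_id K_supported)
  next
    fix k l m S T x
    show "mat_apply N k (mat_mult N l T S) x = mat_apply N l T (mat_apply N k S x)"
      by (rule mat_apply_mat_mult)
  next
    fix k l m t
    show "flatten (k + l) (tensor_map (flatten k) id t) =
        flatten k (tensor_map id (flatten l) (tensor_assoc t))"
      by (rule flatten_assoc)
  next
    fix k k' l l' T S t
    show "mat_apply N (k + l) (mat_tensor k k' T S) (flatten k t) =
        flatten k' (tensor_map (mat_apply N k T) (mat_apply N l S) t)"
      by (rule mat_apply_mat_tensor)
  next
    fix k l m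
    show "let P1 = orth_proj (flatten (k + l) ` tensor_space (K_space N P (k + l)) (K_space N P m));
        P2 = orth_proj (flatten k ` tensor_space (K_space N P k) (K_space N P (l + m)));
        P3 = orth_proj ((\<lambda>t. flatten (k + l) (tensor_map (flatten k) id t)) `
               tensor_space (tensor_space (K_space N P k) (K_space N P l)) (K_space N P m))
      in op_le_on (K_space N P (k + l + m)) (P1 \<circ> P2) P3"
      using projections_compose by (simp add: Let_def op_le_on_def cinner_def)
  qed
qed

end
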